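(* Let $V$ be a finite-dimensional representation of $Y=Y_\hbar(\mathfrak g)$, let $v\in V$ and $f\in V^*$. Then for each $i\in I$, one has $$\tau_i(\mathscr T_{f,v}(u))=\mathscr T_{\tau_i(f),\tau_i(v)}(u).$$ Moreover, the adjoint action of any $x\in\mathfrak g$ on $\mathscr T_{f,v}(u)$ is given by $$[x,\mathscr T_{f,v}(u)]=\mathscr T_{x\cdot f,v}(u)+\mathscr T_{f,x\cdot v}(u).$$
   Context: $\mathfrak g$ is a simple Lie algebra over $\mathbb C$ with Cartan matrix $(a_{ij})_{i,j\in I}$, Chevalley generators $e_i,h_i,f_i$, positive roots $\Delta^+$, minimal symmetrizing integers $d_i$ ($d_ia_{ij}=d_ja_{ji}$); $(\cdot,\cdot)$ is the invariant form with $(\alpha_i,\alpha_j)=d_ia_{ij}$. Fix $\hbar\in\mathbb C^\times$. $Y=Y_\hbar(\mathfrak g)$ is the unital associative $\mathbb C$-algebra generated by $\xi_{i,r},x^\pm_{i,r}$ ($i\in I,r\ge0$) with relations: $[\xi_{i,r},\xi_{j,s}]=0$; $[\xi_{i,0},x^\pm_{j,s}]=\pm d_ia_{ij}x^\pm_{j,s}$; $[\xi_{i,r+1},x^\pm_{j,s}]-[\xi_{i,r},x^\pm_{j,s+1}]=\pm\hbar\frac{d_ia_{ij}}2(\xi_{i,r}x^\pm_{j,s}+x^\pm_{j,s}\xi_{i,r})$; $[x^\pm_{i,r+1},x^\pm_{j,s}]-[x^\pm_{i,r},x^\pm_{j,s+1}]=\pm\hbar\frac{d_ia_{ij}}2(x^\pm_{i,r}x^\pm_{j,s}+x^\pm_{j,s}x^\pm_{i,r})$;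 $[x^+_{i,r},x^-_{j,s}]=\delta_{ij}\xi_{i,r+s}$; and for $i\ne j$, $m=1-a_{ij}$: $\sum_{\pi\in S_m}[x^\pm_{i,r_{\pi(1)}},[x^\pm_{i,r_{\pi(2)}},\cdots[x^\pm_{i,r_{\pi(m)}},x^\pm_{j,s}]\cdots]]=0$. Set $\xi_i(u)=1+\hbar\sum_{r\ge0}\xi_{i,r}u^{-r-1}$, $x_i^\pm(u)=\hbar\sum_{r\ge0}x^\pm_{i,r}u^{-r-1}$, $\log\xi_i(u)=\hbar\sum_{r\ge0}t_{i,r}u^{-r-1}$. $U(\mathfrak g)\subset Y$ via $e_i\mapsto d_i^{-1/2}x^+_{i,0}$, $h_i\mapsto d_i^{-1}\xi_{i,0}$, $f_i\mapsto d_i^{-1/2}x^-_{i,0}$. The coproduct $\Delta$ of $Y$ extends that of $U(\mathfrak g)$ and satisfies $\Delta(t_{i,1})=t_{i,1}\otimes1+1\otimes t_{i,1}-\hbar\sum_{\alpha\in\Delta^+}(\alpha_i,\alpha)x_\alpha^-\otimes x_\alpha^+$, where $x_\alpha^\pm\in\mathfrak g_{\pm\alpha}$, $(x_\alpha^+,x_\alpha^-)=1$. With the shift homomorphism $\theta_z:Y\to Y[z]$, $y(u)\mapsto y(u-z)$ for $y\in\{\xi_i,x_i^\pm\}$, the universal $R$-matrix $\mathcal R(z)\in1+z^{-1}Y^{\otimes2}[[z^{-1}]]$ is the unique element with $(\theta_z\otimes\mathrm{Id})\Delta^{op}(x)=\mathcal R(z)(\theta_z\otimes\mathrm{Id})(\Delta(x))\mathcal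 R(z)^{-1}$ for all $x\in Y$, $(\Delta\otimes\mathrm{Id})(\mathcal R(z))=\mathcal R_{13}(z)\mathcal R_{23}(z)$, $(\mathrm{Id}\otimes\Delta)(\mathcal R(z))=\mathcal R_{13}(z)\mathcal R_{12}(z)$. For a finite-dimensional $Y$-module $V$ with action $\pi_V:Y\to\mathrm{End}(V)$, set $\mathscr T_V(u)=(\pi_V\otimes\mathrm{Id})(\mathcal R_{21}(-u))\in\mathrm{End}(V)\otimes Y[[u^{-1}]]$; the lifted minor attached to $(v,f)\in V\times V^*$ is $\mathscr T_{f,v}(u)=(f\otimes\mathrm{Id})(\mathscr T_V(u)v)\in Y[[u^{-1}]]$. For any integrable $\mathfrak g$-module $(M,\phi)$, $\tau_i$ acts on $M$ by $\tau_i^M=\exp(\phi(e_i))\exp(\phi(-f_i))\exp(\phi(e_i))$. This is applied to $M=Y$ (adjoint action, extended coefficientwise to series), $M=V$, and $M=V^*$ with $(x\cdot f)(v)=-f(x\cdot v)$, so that $\tau_i(f)=f\circ(\tau_i^V)^{-1}$. *)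

theory Defs
  imports
    Complex_Main
    "HOL-Library.Poly_Mapping"
    "HOL-Combinatorics.Permutations"
    "HOL-Computational_Algebra.Formal_Laurent_Series"
begin

section \<open>Complex vector spaces and algebras\<close>

class scaleC =
  fixes scaleC :: "complex \<Rightarrow> 'a \<Rightarrow> 'a" (infixr \<open>*\<^sub>C\<close> 75)

class complex_vector = scaleC + ab_group_add +
  assumes scaleC_add_right: "a *\<^sub>C (x + y) = a *\<^sub>C x + a *\<^sub>C y"
    and scaleC_add_left: "(a + b) *\<^sub>C x = a *\<^sub>C x + b *\<^sub>C x"
    and scaleC_scaleC: "a *\<^sub>C b *\<^sub>C x = (a * b) *\<^sub>C x"
    and scaleC_one: "1 *\<^sub>C x = x"

class complex_algebra = complex_vector + ring +
  assumes mult_scaleC_left: "a *\<^sub>C x * y = a *\<^sub>C (x * y)"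
    and mult_scaleC_right: "x * a *\<^sub>C y = a *\<^sub>C (x * y)"

class complex_algebra_1 = complex_algebra + ring_1

global_interpretation complex_vector: vector_space "scaleC :: complex \<Rightarrow> 'a \<Rightarrow> 'a::complex_vector"
  defines cspan = complex_vector.span
    and csubspace = complex_vector.subspace
    and cdependent = complex_vector.dependent
  by unfold_locales (simp_all add: scaleC_add_right scaleC_add_left scaleC_scaleC scaleC_one)

abbreviation clinear :: "('a::complex_vector \<Rightarrow> 'b::complex_vector) \<Rightarrow> bool"
  where "clinear \<equiv> Vector_Spaces.linear scaleC scaleC"

definition cbilinear :: "('a::complex_vector \<Rightarrow> 'b::complex_vector \<Rightarrow> 'c::complex_vector) \<Rightarrow> bool"
  where "cbilinear \<beta> \<longleftrightarrow> (\<forall>x. clinear (\<beta> x)) \<and> (\<forall>y. clinear (\<lambda>x. \<beta> x y))"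

definition algebra_hom ::
    "('a::{complex_algebra,monoid_mult} \<Rightarrow> 'b::{complex_algebra,monoid_mult}) \<Rightarrow> bool"
  where "algebra_hom F \<longleftrightarrow> clinear F \<and> F 1 = 1 \<and> (\<forall>x y. F (x * y) = F x * F y)"

definition commutator :: "'a::ring \<Rightarrow> 'a \<Rightarrow> 'a"
  where "commutator x y = x * y - y * x"

lemma clinearI:
  fixes f :: "'a::complex_vector \<Rightarrow> 'b::complex_vector"
  assumes "\<And>x y. f (x + y) = f x + f y" "\<And>c x. f (c *\<^sub>C x) = c *\<^sub>C f x"
  shows "clinear f"
  by unfold_locales (use assms in auto)

lemma clinear_add: "clinear f \<Longrightarrow> f (x + y) = f x + f y"
  and clinear_diff: "clinear f \<Longrightarrow> f (x - y) = f x - f y"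
  and clinear_zero: "clinear f \<Longrightarrow> f 0 = 0"
  and clinear_scale: "clinear f \<Longrightarrow> f (c *\<^sub>C x) = c *\<^sub>C f x"
  using module_hom.add module_hom.diff module_hom.zero module_hom.scale
  unfolding linear_iff_module_hom by blast+

lemma clinear_pointwise_add:
  fixes f g :: "'a::complex_vector \<Rightarrow> 'b::complex_vector"
  shows "clinear f \<Longrightarrow> clinear g \<Longrightarrow> clinear (\<lambda>x. f x + g x)"
  by (rule clinearI) (simp_all add: clinear_add clinear_scale scaleC_add_right)

lemma clinear_pointwise_diff:
  fixes f g :: "'a::complex_vector \<Rightarrow> 'b::complex_vector"
  shows "clinear f \<Longrightarrow> clinear g \<Longrightarrow> clinear (\<lambda>x. f x - g x)"
  by (rule clinearI)
    (simp_all add: clinear_add clinear_scale complex_vector.scale_right_diff_distrib)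

lemma clinear_pointwise_neg:
  fixes f :: "'a::complex_vector \<Rightarrow> 'b::complex_vector"
  shows "clinear f \<Longrightarrow> clinear (\<lambda>x. - f x)"
  by (rule clinearI) (simp_all add: clinear_add clinear_scale)

lemma clinear_pointwise_scale:
  fixes f :: "'a::complex_vector \<Rightarrow> 'b::complex_vector"
  shows "clinear f \<Longrightarrow> clinear (\<lambda>x. c *\<^sub>C f x)"
  by (rule clinearI)
    (simp_all add: clinear_add clinear_scale scaleC_add_right scaleC_scaleC mult.commute)

lemma clinear_composition:
  fixes f :: "'b::complex_vector \<Rightarrow> 'c::complex_vector" and g :: "'a::complex_vector \<Rightarrow> 'b"
  shows "clinear f \<Longrightarrow> clinear g \<Longrightarrow> clinear (\<lambda>x. f (g x))"
  by (rule clinearI) (simp_all add: clinear_add clinear_scale)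

instantiation complex :: complex_algebra_1
begin

definition complex_scaleC_def [simp]: "scaleC a (x::complex) = a * x"

instance by standard (simp_all add: algebra_simps)

end

instantiation poly_mapping :: (type, complex_vector) complex_vector
begin

lift_definition scaleC_poly_mapping :: "complex \<Rightarrow> ('a \<Rightarrow>\<^sub>0 'b) \<Rightarrow> ('a \<Rightarrow>\<^sub>0 'b)"
  is "\<lambda>c f k. c *\<^sub>C f k"
proof -
  fix c :: complex and f :: "'a \<Rightarrow> 'b"
  assume "finite {x. f x \<noteq> 0}"
  then show "finite {x. c *\<^sub>C f x \<noteq> 0}"
    by (rule rev_finite_subset) auto
qed

instance
  by standard (transfer; simp add: fun_eq_iff scaleC_add_right scaleC_add_left scaleC_scaleC scaleC_one)+

end

lemma lookup_scaleC: "Poly_Mapping.lookup (c *\<^sub>C p) k = c *\<^sub>C Poly_Mapping.lookup p k"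
  by transfer simp

lemma poly_mapping_sum_single:
  "p = (\<Sum>k\<in>Poly_Mapping.keys p. Poly_Mapping.single k (Poly_Mapping.lookup p k))"
  for p :: "'k \<Rightarrow>\<^sub>0 'b::ab_group_add"
  by (rule poly_mapping_eqI)
    (auto simp: lookup_sum lookup_single when_def sum.delta in_keys_iff cong: if_cong)

lemma poly_mapping_induct_single:
  fixes p :: "'k \<Rightarrow>\<^sub>0 'b::ab_group_add"
  assumes "P 0" "\<And>k b. P (Poly_Mapping.single k b)" "\<And>p q. P p \<Longrightarrow> P q \<Longrightarrow> P (p + q)"
  shows "P p"
proof -
  have "P (\<Sum>k\<in>A. Poly_Mapping.single k (Poly_Mapping.lookup p k))" if "finite A" for A
    using that by induction (auto intro: assms)
  from this[of "Poly_Mapping.keys p"] show ?thesis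
    by (metis finite_keys poly_mapping_sum_single)
qed

lemma scaleC_single: "c *\<^sub>C Poly_Mapping.single k b = Poly_Mapping.single k (c *\<^sub>C b)"
  by (rule poly_mapping_eqI) (simp add: lookup_scaleC lookup_single when_def)

instance poly_mapping :: (monoid_add, complex_algebra) complex_algebra
proof
  fix c :: complex and p q :: "'a \<Rightarrow>\<^sub>0 'b"
  show "c *\<^sub>C p * q = c *\<^sub>C (p * q)"
  proof (induction p rule: poly_mapping_induct_single)
    case (2 k b)
    show ?case
      by (induction q rule: poly_mapping_induct_single)
        (simp_all add: scaleC_single mult_single mult_scaleC_left algebra_simps scaleC_add_right)
  qed (simp_all add: algebra_simps scaleC_add_right)
  show "p * c *\<^sub>C q = c *\<^sub>C (p * q)"
  proof (induction p rule: poly_mapping_induct_single)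
    case (2 k b)
    show ?case
      by (induction q rule: poly_mapping_induct_single)
        (simp_all add: scaleC_single mult_single mult_scaleC_right algebra_simps scaleC_add_right)
  qed (simp_all add: algebra_simps scaleC_add_right)
qed

instance poly_mapping :: (monoid_add, complex_algebra_1) complex_algebra_1 ..


section \<open>Tensor products\<close>

text \<open>The tensor product is the free vector space on pairs modulo the bilinearity relations.\<close>

definition tensor_relators :: "('a::complex_vector \<times> 'b::complex_vector \<Rightarrow>\<^sub>0 complex) set"
  where "tensor_relators =
    {Poly_Mapping.single (x + x', y) 1 - Poly_Mapping.single (x, y) 1 - Poly_Mapping.single (x', y) 1
      | x x' y. True} \<union>
    {Poly_Mapping.single (x, y + y') 1 - Poly_Mapping.single (x, y) 1 - Poly_Mapping.single (x, y') 1
      | x y y'. True} \<union>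
    {Poly_Mapping.single (c *\<^sub>C x, y) 1 - c *\<^sub>C Poly_Mapping.single (x, y) 1 | c x y. True} \<union>
    {Poly_Mapping.single (x, c *\<^sub>C y) 1 - c *\<^sub>C Poly_Mapping.single (x, y) 1 | c x y. True}"

definition tensor_eq ::
    "('a::complex_vector \<times> 'b::complex_vector \<Rightarrow>\<^sub>0 complex) \<Rightarrow> ('a \<times> 'b \<Rightarrow>\<^sub>0 complex) \<Rightarrow> bool"
  where "tensor_eq p q \<longleftrightarrow> p - q \<in> cspan tensor_relators"

lemma equivp_tensor_eq: "equivp tensor_eq"
proof (rule equivpI)
  show "reflp tensor_eq"
    by (simp add: reflp_def tensor_eq_def complex_vector.span_zero)
  show "symp tensor_eq"
    unfolding symp_def tensor_eq_def by (metis complex_vector.span_neg minus_diff_eq)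
  show "transp tensor_eq"
  proof (rule transpI)
    fix p q r
    assume "tensor_eq p q" "tensor_eq q r"
    then have "(p - q) + (q - r) \<in> cspan tensor_relators"
      unfolding tensor_eq_def by (rule complex_vector.span_add)
    then show "tensor_eq p r" by (simp add: tensor_eq_def)
  qed
qed

quotient_type (overloaded) ('a, 'b) tensor =
  "'a::complex_vector \<times> 'b::complex_vector \<Rightarrow>\<^sub>0 complex" / tensor_eq
  by (rule equivp_tensor_eq)

lift_definition tens :: "'a::complex_vector \<Rightarrow> 'b::complex_vector \<Rightarrow> ('a, 'b) tensor"
    (infixl \<open>\<otimes>\<^sub>C\<close> 76)
  is "\<lambda>x y. Poly_Mapping.single (x, y) 1" .

instantiation tensor :: (complex_vector, complex_vector) complex_vector
begin

lift_definition zero_tensor :: "('a, 'b) tensor" is 0 .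
lift_definition plus_tensor :: "('a, 'b) tensor \<Rightarrow> ('a, 'b) tensor \<Rightarrow> ('a, 'b) tensor" is "(+)"
  unfolding tensor_eq_def by (subst add_diff_add) (rule complex_vector.span_add)
lift_definition minus_tensor :: "('a, 'b) tensor \<Rightarrow> ('a, 'b) tensor \<Rightarrow> ('a, 'b) tensor" is "(-)"
proof -
  fix p p' q q' :: "'a \<times> 'b \<Rightarrow>\<^sub>0 complex"
  assume "tensor_eq p p'" "tensor_eq q q'"
  then have "(p - p') - (q - q') \<in> cspan tensor_relators"
    unfolding tensor_eq_def by (rule complex_vector.span_diff)
  moreover have "(p - p') - (q - q') = (p - q) - (p' - q')" by simp
  ultimately show "tensor_eq (p - q) (p' - q')" by (simp only: tensor_eq_def)
qed
lift_definition uminus_tensor :: "('a, 'b) tensor \<Rightarrow> ('a, 'b) tensor" is uminus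
  unfolding tensor_eq_def by (subst minus_diff_minus) (rule complex_vector.span_neg)
lift_definition scaleC_tensor :: "complex \<Rightarrow> ('a, 'b) tensor \<Rightarrow> ('a, 'b) tensor" is scaleC
  unfolding tensor_eq_def
  by (subst complex_vector.scale_right_diff_distrib[symmetric]) (rule complex_vector.span_scale)

instance
proof
  fix x y z :: "('a, 'b) tensor" and a b :: complex
  have refl: "tensor_eq p p" for p :: "'a \<times> 'b \<Rightarrow>\<^sub>0 complex"
    by (simp add: tensor_eq_def complex_vector.span_zero)
  show "x + y + z = x + (y + z)" by transfer (simp add: add.assoc refl)
  show "x + y = y + x" by transfer (simp add: add.commute refl)
  show "0 + x = x" by transfer (simp add: refl)
  show "- x + x = 0" by transfer (simp add: refl)
  show "x - y = x + - y" by transfer (simp add: refl)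
  show "a *\<^sub>C (x + y) = a *\<^sub>C x + a *\<^sub>C y" by transfer (simp add: scaleC_add_right refl)
  show "(a + b) *\<^sub>C x = a *\<^sub>C x + b *\<^sub>C x" by transfer (simp add: scaleC_add_left refl)
  show "a *\<^sub>C b *\<^sub>C x = (a * b) *\<^sub>C x" by transfer (simp add: scaleC_scaleC refl)
  show "1 *\<^sub>C x = x" by transfer (simp add: scaleC_one refl)
qed

end

lemma tens_add_left: "(x + x') \<otimes>\<^sub>C y = x \<otimes>\<^sub>C y + x' \<otimes>\<^sub>C y"
  by (transfer, unfold tensor_eq_def diff_diff_eq[symmetric], rule complex_vector.span_base,
      unfold tensor_relators_def, intro UnI1, blast)

lemma tens_add_right: "x \<otimes>\<^sub>C (y + y') = x \<otimes>\<^sub>C y + x \<otimes>\<^sub>C y'"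
  by (transfer, unfold tensor_eq_def diff_diff_eq[symmetric], rule complex_vector.span_base,
      unfold tensor_relators_def, rule UnI1, rule UnI1, rule UnI2, blast)

lemma tens_scaleC_left: "(c *\<^sub>C x) \<otimes>\<^sub>C y = c *\<^sub>C (x \<otimes>\<^sub>C y)"
  by (transfer, unfold tensor_eq_def, rule complex_vector.span_base,
      unfold tensor_relators_def, rule UnI1, rule UnI2, blast)

lemma tens_scaleC_right: "x \<otimes>\<^sub>C (c *\<^sub>C y) = c *\<^sub>C (x \<otimes>\<^sub>C y)"
  by (transfer, unfold tensor_eq_def, rule complex_vector.span_base,
      unfold tensor_relators_def, rule UnI2, blast)

lemma tensor_induct [case_names zero tens add, induct type: tensor]:
  fixes t :: "('a::complex_vector, 'b::complex_vector) tensor"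
  assumes "P 0" "\<And>x y. P (x \<otimes>\<^sub>C y)" "\<And>s t. P s \<Longrightarrow> P t \<Longrightarrow> P (s + t)"
  shows "P t"
proof (induction t rule: tensor.abs_induct)
  case (1 p)
  show ?case
  proof (induction p rule: poly_mapping_induct_single)
    case 1
    show ?case using assms(1) by (simp add: zero_tensor_def)
  next
    case (2 k c)
    obtain x y where k: "k = (x, y)" by force
    have "abs_tensor (Poly_Mapping.single k c) = c *\<^sub>C (x \<otimes>\<^sub>C y)"
      by (simp add: k tens.abs_eq scaleC_tensor.abs_eq scaleC_single)
    also have "\<dots> = (c *\<^sub>C x) \<otimes>\<^sub>C y" by (simp add: tens_scaleC_left)
    finally show ?case using assms(2) by simp
  next
    case (3 p q)
    then show ?case using assms(3) by (metis plus_tensor.abs_eq)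
  qed
qed

text \<open>\<open>tensor_lift \<beta>\<close> is the linear map with \<open>x \<otimes> y \<mapsto> \<beta> x y\<close>.  It is only meaningful for
  bilinear \<open>\<beta>\<close>; otherwise the value depends on the chosen representative.\<close>

definition free_extension ::
    "('a \<Rightarrow> 'b \<Rightarrow> 'c::complex_vector) \<Rightarrow> ('a \<times> 'b \<Rightarrow>\<^sub>0 complex) \<Rightarrow> 'c"
  where "free_extension \<beta> p =
    (\<Sum>k\<in>Poly_Mapping.keys p. Poly_Mapping.lookup p k *\<^sub>C \<beta> (fst k) (snd k))"

definition tensor_lift ::
    "('a::complex_vector \<Rightarrow> 'b::complex_vector \<Rightarrow> 'c::complex_vector) \<Rightarrow> ('a, 'b) tensor \<Rightarrow> 'c"
  where "tensor_lift \<beta> t = free_extension \<beta> (rep_tensor t)"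

lemma free_extension_superset:
  assumes "finite A" "Poly_Mapping.keys p \<subseteq> A"
  shows "free_extension \<beta> p = (\<Sum>k\<in>A. Poly_Mapping.lookup p k *\<^sub>C \<beta> (fst k) (snd k))"
  unfolding free_extension_def
  by (rule sum.mono_neutral_left) (use assms in \<open>auto simp: in_keys_iff\<close>)

lemma clinear_free_extension: "clinear (free_extension \<beta>)"
proof (rule clinearI)
  fix p q :: "'a \<times> 'b \<Rightarrow>\<^sub>0 complex" and c
  let ?A = "Poly_Mapping.keys p \<union> Poly_Mapping.keys q"
  have "Poly_Mapping.keys (p + q) \<subseteq> ?A" by (rule Poly_Mapping.keys_add)
  then show "free_extension \<beta> (p + q) = free_extension \<beta> p + free_extension \<beta> q"
    by (simp add: free_extension_superset[of ?A] lookup_add scaleC_add_left sum.distrib)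
  have "Poly_Mapping.keys (c *\<^sub>C p) \<subseteq> Poly_Mapping.keys p"
    by (auto simp: in_keys_iff lookup_scaleC)
  then show "free_extension \<beta> (c *\<^sub>C p) = c *\<^sub>C free_extension \<beta> p"
    by (simp add: free_extension_superset[of "Poly_Mapping.keys p"] lookup_scaleC
        complex_vector.scale_sum_right)
qed

lemma free_extension_single: "free_extension \<beta> (Poly_Mapping.single (x, y) 1) = \<beta> x y"
  by (simp add: free_extension_def scaleC_one)

lemma free_extension_tensor_eq:
  assumes \<beta>: "cbilinear \<beta>" and eq: "tensor_eq p q"
  shows "free_extension \<beta> p = free_extension \<beta> q"
proof -
  have "free_extension \<beta> r = 0" if "r \<in> cspan tensor_relators" for r
    using that
  proof (induction rule: complex_vector.span_induct_alt)
    case base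
    show ?case by (rule clinear_zero[OF clinear_free_extension])
  next
    case (step c x y)
    have "free_extension \<beta> x = 0"
      using step(1) \<beta> unfolding tensor_relators_def cbilinear_def
      by (auto simp: clinear_diff[OF clinear_free_extension] clinear_scale[OF clinear_free_extension]
          free_extension_single clinear_add clinear_scale
          clinear_add[where f = "\<lambda>x. \<beta> x _"] clinear_scale[where f = "\<lambda>x. \<beta> x _"])
    then show ?case
      using step(2)
      by (simp add: clinear_add[OF clinear_free_extension] clinear_scale[OF clinear_free_extension])
  qed
  from this[OF eq[unfolded tensor_eq_def]] show ?thesis
    by (simp add: clinear_diff[OF clinear_free_extension])
qed

lemma tensor_lift_abs: "cbilinear \<beta> \<Longrightarrow> tensor_lift \<beta> (abs_tensor p) = free_extension \<beta> p"
  unfolding tensor_lift_def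
  by (erule free_extension_tensor_eq)
    (rule Quotient_rep_abs[OF Quotient_tensor equivp_reflp[OF equivp_tensor_eq]])

lemma tensor_lift_tens: "cbilinear \<beta> \<Longrightarrow> tensor_lift \<beta> (x \<otimes>\<^sub>C y) = \<beta> x y"
  by (simp add: tens.abs_eq tensor_lift_abs free_extension_single)

lemma clinear_tensor_lift:
  assumes "cbilinear \<beta>"
  shows "clinear (tensor_lift \<beta>)"
proof (rule clinearI)
  show "tensor_lift \<beta> (s + t) = tensor_lift \<beta> s + tensor_lift \<beta> t" for s t
    by (induction s rule: tensor.abs_induct, induction t rule: tensor.abs_induct)
      (simp add: plus_tensor.abs_eq tensor_lift_abs[OF assms] clinear_add[OF clinear_free_extension])
  show "tensor_lift \<beta> (c *\<^sub>C t) = c *\<^sub>C tensor_lift \<beta> t" for c t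
    by (induction t rule: tensor.abs_induct)
      (simp add: scaleC_tensor.abs_eq tensor_lift_abs[OF assms] clinear_scale[OF clinear_free_extension])
qed


lemma cbilinearI:
  fixes \<beta> :: "'a::complex_vector \<Rightarrow> 'b::complex_vector \<Rightarrow> 'c::complex_vector"
  assumes "\<And>x x' y. \<beta> (x + x') y = \<beta> x y + \<beta> x' y"
    and "\<And>x y y'. \<beta> x (y + y') = \<beta> x y + \<beta> x y'"
    and "\<And>c x y. \<beta> (c *\<^sub>C x) y = c *\<^sub>C \<beta> x y"
    and "\<And>c x y. \<beta> x (c *\<^sub>C y) = c *\<^sub>C \<beta> x y"
  shows "cbilinear \<beta>"
  unfolding cbilinear_def by (auto intro!: clinearI simp: assms)

definition tensor_map ::
    "('a::complex_vector \<Rightarrow> 'c::complex_vector) \<Rightarrow> ('b::complex_vector \<Rightarrow> 'd::complex_vector) \<Rightarrow>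
     ('a, 'b) tensor \<Rightarrow> ('c, 'd) tensor"
  where "tensor_map f g = tensor_lift (\<lambda>x y. f x \<otimes>\<^sub>C g y)"

definition tensor_flip :: "('a::complex_vector, 'b::complex_vector) tensor \<Rightarrow> ('b, 'a) tensor"
  where "tensor_flip = tensor_lift (\<lambda>x y. y \<otimes>\<^sub>C x)"

definition tensor_assoc ::
    "('a::complex_vector, ('b::complex_vector, 'c::complex_vector) tensor) tensor \<Rightarrow>
     (('a, 'b) tensor, 'c) tensor"
  where "tensor_assoc = tensor_lift (\<lambda>x. tensor_lift (\<lambda>y z. (x \<otimes>\<^sub>C y) \<otimes>\<^sub>C z))"

instantiation tensor :: (complex_algebra, complex_algebra) complex_algebra
begin

definition times_tensor :: "('a, 'b) tensor \<Rightarrow> ('a, 'b) tensor \<Rightarrow> ('a, 'b) tensor"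
  where "s * t = tensor_lift (\<lambda>a b. tensor_lift (\<lambda>c d. (a * c) \<otimes>\<^sub>C (b * d)) t) s"

lemma tensor_times_inner: "cbilinear (\<lambda>c d. (a * c) \<otimes>\<^sub>C (b * d))" for a :: 'a and b :: 'b
  by (rule cbilinearI)
    (simp_all add: distrib_left mult_scaleC_right tens_add_left tens_add_right
      tens_scaleC_left tens_scaleC_right)

lemma tensor_times_outer: "cbilinear (\<lambda>a b. tensor_lift (\<lambda>c d. (a * c) \<otimes>\<^sub>C (b * d)) t)"
  for t :: "('a, 'b) tensor"
proof (induction t)
  case zero
  show ?case by (simp add: clinear_zero[OF clinear_tensor_lift[OF tensor_times_inner]] cbilinearI)
next
  case (tens x y)
  show ?case
    unfolding tensor_lift_tens[OF tensor_times_inner]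
    by (rule cbilinearI)
      (simp_all add: distrib_right mult_scaleC_left tens_add_left
        tens_add_right tens_scaleC_left tens_scaleC_right)
next
  case (add s t)
  from add show ?case
    by (simp add: clinear_add[OF clinear_tensor_lift[OF tensor_times_inner]] cbilinear_def clinear_pointwise_add)
qed

lemma tensor_times_clinear_right: "clinear (\<lambda>t. s * t)" for s :: "('a, 'b) tensor"
proof (induction s)
  case zero
  show ?case
    by (simp add: times_tensor_def clinear_zero[OF clinear_tensor_lift[OF tensor_times_outer]] clinearI)
next
  case (tens x y)
  show ?case
    by (simp add: times_tensor_def tensor_lift_tens[OF tensor_times_outer] clinear_tensor_lift[OF tensor_times_inner])
next
  case (add s t)
  from add show ?case
    by (simp add: times_tensor_def clinear_add[OF clinear_tensor_lift[OF tensor_times_outer]]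
        clinear_pointwise_add)
qed

lemma tensor_times_clinear_left: "clinear (\<lambda>s. s * t)" for t :: "('a, 'b) tensor"
  by (simp add: times_tensor_def clinear_tensor_lift[OF tensor_times_outer])

lemma tensor_times_tens: "(a \<otimes>\<^sub>C b) * (c \<otimes>\<^sub>C d) = (a * c) \<otimes>\<^sub>C (b * d)" for a c :: 'a and b d :: 'b
  unfolding times_tensor_def
  by (subst tensor_lift_tens[OF tensor_times_outer]) (rule tensor_lift_tens[OF tensor_times_inner])

instance
proof
  fix r s t :: "('a, 'b) tensor" and c :: complex
  show dl: "(r + s) * t = r * t + s * t" for r s t :: "('a, 'b) tensor"
    by (rule clinear_add[OF tensor_times_clinear_left])
  show dr: "r * (s + t) = r * s + r * t" for r s t :: "('a, 'b) tensor"
    by (rule clinear_add[OF tensor_times_clinear_right])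
  have zl: "0 * t = 0" for t :: "('a, 'b) tensor" by (rule clinear_zero[OF tensor_times_clinear_left])
  have zr: "t * 0 = 0" for t :: "('a, 'b) tensor" by (rule clinear_zero[OF tensor_times_clinear_right])
  show "c *\<^sub>C s * t = c *\<^sub>C (s * t)" by (rule clinear_scale[OF tensor_times_clinear_left])
  show "s * c *\<^sub>C t = c *\<^sub>C (s * t)" by (rule clinear_scale[OF tensor_times_clinear_right])
  show "r * s * t = r * (s * t)"
  proof (induction r)
    case (tens a b)
    show ?case
    proof (induction s)
      case (tens c d)
      show ?case
        by (induction t) (simp_all add: zr dr tensor_times_tens mult.assoc)
    qed (simp_all add: zl zr dl dr)
  qed (simp_all add: zl dl)
qed

end

lemma tens_times_tens: "(a \<otimes>\<^sub>C b) * (c \<otimes>\<^sub>C d) = (a * c) \<otimes>\<^sub>C (b * d)"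
  for a c :: "'a::complex_algebra" and b d :: "'b::complex_algebra"
  by (rule tensor_times_tens)

instantiation tensor :: (complex_algebra_1, complex_algebra_1) complex_algebra_1
begin

definition one_tensor :: "('a, 'b) tensor"
  where "1 = 1 \<otimes>\<^sub>C 1"

instance
proof
  fix t :: "('a, 'b) tensor"
  show "1 * t = t" by (induction t) (simp_all add: one_tensor_def tens_times_tens distrib_left)
  show "t * 1 = t" by (induction t) (simp_all add: one_tensor_def tens_times_tens distrib_right)
  have "\<exists>\<phi>. clinear \<phi> \<and> \<phi> (1::'c) = (1::complex)" for dummy :: "'c::complex_algebra_1 itself"
  proof -
    interpret vector_space_pair "scaleC :: complex \<Rightarrow> 'c \<Rightarrow> 'c" "scaleC :: complex \<Rightarrow> complex \<Rightarrow> complex"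
      by unfold_locales
    have "\<not> cdependent {1::'c}" by (simp add: complex_vector.dependent_single)
    from linear_independent_extend[OF this[unfolded cdependent_def], of "\<lambda>_. 1"]
    show ?thesis by auto
  qed
  then obtain \<phi> :: "'a \<Rightarrow> complex" and \<psi> :: "'b \<Rightarrow> complex"
    where *: "clinear \<phi>" "\<phi> 1 = 1" "clinear \<psi>" "\<psi> 1 = 1"
    by meson
  have bil: "cbilinear (\<lambda>a b. \<phi> a * \<psi> b)"
    by (rule cbilinearI)
      (simp_all add: clinear_add[OF *(1)] clinear_add[OF *(3)] clinear_scale[OF *(1)]
        clinear_scale[OF *(3)] algebra_simps)
  have "tensor_lift (\<lambda>a b. \<phi> a * \<psi> b) (1::('a, 'b) tensor) = 1"
    by (simp add: one_tensor_def tensor_lift_tens[OF bil] *)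
  moreover have "tensor_lift (\<lambda>a b. \<phi> a * \<psi> b) (0::('a, 'b) tensor) = 0"
    by (rule clinear_zero[OF clinear_tensor_lift[OF bil]])
  ultimately show "(0::('a, 'b) tensor) \<noteq> 1" by auto
qed

end


section \<open>Endomorphisms and the dual space\<close>

typedef (overloaded) 'v cend = "{A :: 'v::complex_vector \<Rightarrow> 'v. clinear A}"
  morphisms cend_apply Abs_cend
  by (rule exI[of _ "\<lambda>x. x"]) (simp add: clinearI)

setup_lifting type_definition_cend

instantiation cend :: (complex_vector) "{complex_algebra, monoid_mult}"
begin

lift_definition zero_cend :: "'a cend" is "\<lambda>_. 0" by (simp add: clinearI)
lift_definition one_cend :: "'a cend" is "\<lambda>v. v" by (simp add: clinearI)
lift_definition plus_cend :: "'a cend \<Rightarrow> 'a cend \<Rightarrow> 'a cend" is "\<lambda>A B v. A v + B v"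
  by (rule clinear_pointwise_add)
lift_definition minus_cend :: "'a cend \<Rightarrow> 'a cend \<Rightarrow> 'a cend" is "\<lambda>A B v. A v - B v"
  by (rule clinear_pointwise_diff)
lift_definition uminus_cend :: "'a cend \<Rightarrow> 'a cend" is "\<lambda>A v. - A v"
  by (rule clinear_pointwise_neg)
lift_definition times_cend :: "'a cend \<Rightarrow> 'a cend \<Rightarrow> 'a cend" is "\<lambda>A B v. A (B v)"
  by (rule clinear_composition)
lift_definition scaleC_cend :: "complex \<Rightarrow> 'a cend \<Rightarrow> 'a cend" is "\<lambda>c A v. c *\<^sub>C A v"
  by (rule clinear_pointwise_scale)

instance
  by standard
    (transfer;
      simp add: fun_eq_iff scaleC_add_right scaleC_add_left scaleC_scaleC scaleC_one
        clinear_add clinear_scale)+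

end

typedef (overloaded) 'v cdual = "{f :: 'v::complex_vector \<Rightarrow> complex. clinear f}"
  morphisms cdual_apply Abs_cdual
  by (rule exI[of _ "\<lambda>_. 0"]) (simp add: clinearI)

setup_lifting type_definition_cdual

instantiation cdual :: (complex_vector) complex_vector
begin

lift_definition zero_cdual :: "'a cdual" is "\<lambda>_. 0" by (simp add: clinearI)
lift_definition plus_cdual :: "'a cdual \<Rightarrow> 'a cdual \<Rightarrow> 'a cdual" is "\<lambda>f g v. f v + g v"
  by (rule clinear_pointwise_add)
lift_definition minus_cdual :: "'a cdual \<Rightarrow> 'a cdual \<Rightarrow> 'a cdual" is "\<lambda>f g v. f v - g v"
  by (rule clinear_pointwise_diff)
lift_definition uminus_cdual :: "'a cdual \<Rightarrow> 'a cdual" is "\<lambda>f v. - f v"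
  by (rule clinear_pointwise_neg)
lift_definition scaleC_cdual :: "complex \<Rightarrow> 'a cdual \<Rightarrow> 'a cdual" is "\<lambda>c f v. c *\<^sub>C f v"
  by (rule clinear_pointwise_scale)

instance
  by standard
    (transfer; simp add: fun_eq_iff algebra_simps)+

end

text \<open>The action of \<open>x\<close> on \<open>V*\<close> when \<open>x\<close> acts on \<open>V\<close> by \<open>A\<close>.\<close>

lift_definition contragredient :: "'v::complex_vector cend \<Rightarrow> 'v cdual \<Rightarrow> 'v cdual"
  is "\<lambda>A f v. - f (A v)"
  by (rule clinear_pointwise_neg) (rule clinear_composition)


section \<open>Simple Lie algebras\<close>

locale lie_algebra =
  fixes bracket :: "'g::complex_vector \<Rightarrow> 'g \<Rightarrow> 'g"
  assumes bilinear: "cbilinear bracket"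
    and alternating: "bracket x x = 0"
    and jacobi: "bracket x (bracket y z) + bracket y (bracket z x) + bracket z (bracket x y) = 0"

locale simple_lie_algebra = lie_algebra bracket
  for bracket :: "'g::complex_vector \<Rightarrow> 'g \<Rightarrow> 'g" +
  assumes finite_dimensional: "\<exists>B :: 'g set. finite B \<and> cspan B = UNIV"
    and nonabelian: "\<exists>x y. bracket x y \<noteq> 0"
    and no_proper_ideals:
      "csubspace J \<Longrightarrow> (\<forall>x. \<forall>y\<in>J. bracket x y \<in> J) \<Longrightarrow> J = {0} \<or> J = UNIV"

text \<open>Elements of the root lattice are written as coefficient vectors: \<open>n\<close> stands for
  \<open>\<Sum>\<^sub>j n\<^sub>j \<alpha>\<^sub>j\<close>, where \<open>\<alpha>\<^sub>j(h\<^sub>i) = a\<^sub>i\<^sub>j\<close>.\<close>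

definition root_space ::
    "('g::complex_vector \<Rightarrow> 'g \<Rightarrow> 'g) \<Rightarrow> ('i::finite \<Rightarrow> 'i \<Rightarrow> int) \<Rightarrow> ('i \<Rightarrow> 'g) \<Rightarrow> ('i \<Rightarrow> int) \<Rightarrow> 'g set"
  where "root_space bracket a h n =
    {x. \<forall>i. bracket (h i) x = complex_of_int (\<Sum>j\<in>UNIV. n j * a i j) *\<^sub>C x}"

definition positive_roots ::
    "('g::complex_vector \<Rightarrow> 'g \<Rightarrow> 'g) \<Rightarrow> ('i::finite \<Rightarrow> 'i \<Rightarrow> int) \<Rightarrow> ('i \<Rightarrow> 'g) \<Rightarrow> ('i \<Rightarrow> int) set"
  where "positive_roots bracket a h =
    {n. (\<forall>j. n j \<ge> 0) \<and> n \<noteq> (\<lambda>_. 0) \<and> root_space bracket a h n \<noteq> {0}}"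

text \<open>Cartan matrix and Chevalley generators: the \<open>h\<^sub>i\<close> form a basis of a Cartan subalgebra
  (it is its own centralizer and acts diagonalizably), every root is a nonnegative or a nonpositive
  integral combination of the \<open>\<alpha>\<^sub>j\<close>, and the \<open>e\<^sub>i, f\<^sub>i\<close> are root vectors for \<open>\<plusminus>\<alpha>\<^sub>i\<close> with
  \<open>[e\<^sub>i, f\<^sub>i] = h\<^sub>i\<close>, \<open>\<alpha>\<^sub>i(h\<^sub>i) = 2\<close>.\<close>

locale chevalley_generators = simple_lie_algebra bracket
  for bracket :: "'g::complex_vector \<Rightarrow> 'g \<Rightarrow> 'g" +
  fixes a :: "'i::finite \<Rightarrow> 'i \<Rightarrow> int" and e h f :: "'i \<Rightarrow> 'g"
  assumes h_independent: "inj h" "\<not> cdependent (range h)"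
    and cartan_subalgebra: "root_space bracket a h (\<lambda>_. 0) = cspan (range h)"
    and root_decomposition:
      "cspan (\<Union>n\<in>{n. (\<forall>j. n j \<ge> 0) \<or> (\<forall>j. n j \<le> 0)}. root_space bracket a h n) = UNIV"
    and bracket_h_e: "bracket (h i) (e j) = complex_of_int (a i j) *\<^sub>C e j"
    and bracket_h_f: "bracket (h i) (f j) = - complex_of_int (a i j) *\<^sub>C f j"
    and bracket_e_f: "bracket (e i) (f j) = (if i = j then h i else 0)"
    and cartan_diagonal: "a i i = 2"

definition symmetrizer :: "('i \<Rightarrow> 'i \<Rightarrow> int) \<Rightarrow> ('i \<Rightarrow> nat) \<Rightarrow> bool"
  where "symmetrizer a d \<longleftrightarrow> (\<forall>i. d i > 0) \<and> (\<forall>i j. int (d i) * a i j = int (d j) * a j i)"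

definition minimal_symmetrizer :: "('i \<Rightarrow> 'i \<Rightarrow> int) \<Rightarrow> ('i \<Rightarrow> nat) \<Rightarrow> bool"
  where "minimal_symmetrizer a d \<longleftrightarrow>
    symmetrizer a d \<and> (\<forall>d'. symmetrizer a d' \<longrightarrow> (\<forall>i. d i \<le> d' i))"

text \<open>The invariant form on \<open>\<gg>\<close> whose induced form on the dual of the Cartan subalgebra satisfies
  \<open>(\<alpha>\<^sub>i, \<alpha>\<^sub>j) = d\<^sub>i a\<^sub>i\<^sub>j\<close>; here \<open>t\<^sub>i\<close> is the element of the Cartan subalgebra representing \<open>\<alpha>\<^sub>i\<close>.\<close>

definition normalized_invariant_form ::
    "('g::complex_vector \<Rightarrow> 'g \<Rightarrow> 'g) \<Rightarrow> ('i \<Rightarrow> 'i \<Rightarrow> int) \<Rightarrow> ('i \<Rightarrow> nat) \<Rightarrow> ('i \<Rightarrow> 'g) \<Rightarrow>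
     ('g \<Rightarrow> 'g \<Rightarrow> complex) \<Rightarrow> bool"
  where "normalized_invariant_form bracket a d h B \<longleftrightarrow>
    cbilinear B \<and> (\<forall>x y. B x y = B y x) \<and> (\<forall>x y z. B (bracket x y) z = B x (bracket y z)) \<and>
    (\<exists>t. (\<forall>i. t i \<in> cspan (range h)) \<and> (\<forall>i j. B (t i) (h j) = complex_of_int (a j i)) \<and>
      (\<forall>i j. B (t i) (t j) = complex_of_int (int (d i) * a i j)))"

definition root_vectors ::
    "('g::complex_vector \<Rightarrow> 'g \<Rightarrow> 'g) \<Rightarrow> ('i::finite \<Rightarrow> 'i \<Rightarrow> int) \<Rightarrow> ('i \<Rightarrow> 'g) \<Rightarrow>
     ('g \<Rightarrow> 'g \<Rightarrow> complex) \<Rightarrow> (('i \<Rightarrow> int) \<Rightarrow> 'g) \<Rightarrow> (('i \<Rightarrow> int) \<Rightarrow> 'g) \<Rightarrow> bool"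
  where "root_vectors bracket a h B xp xm \<longleftrightarrow>
    (\<forall>n\<in>positive_roots bracket a h.
      xp n \<in> root_space bracket a h n \<and> xm n \<in> root_space bracket a h (\<lambda>j. - n j) \<and>
      B (xp n) (xm n) = 1)"


section \<open>Algebras presented by generators and relations\<close>

datatype 'x free_monoid = Word (letters: "'x list")

instantiation free_monoid :: (type) monoid_add
begin

definition zero_free_monoid :: "'a free_monoid"
  where "0 = Word []"

definition plus_free_monoid :: "'a free_monoid \<Rightarrow> 'a free_monoid \<Rightarrow> 'a free_monoid"
  where "u + w = Word (letters u @ letters w)"

instance by standard (simp_all add: zero_free_monoid_def plus_free_monoid_def)

end

text \<open>The free unital associative algebra is the monoid algebra of the free monoid; its product is
  the convolution product of the library.\<close>

type_synonym 'x free_algebra = "'x free_monoid \<Rightarrow>\<^sub>0 complex"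

definition free_var :: "'x \<Rightarrow> 'x free_algebra"
  where "free_var x = Poly_Mapping.single (Word [x]) 1"

definition free_eval :: "('x \<Rightarrow> 'y::complex_algebra_1) \<Rightarrow> 'x free_algebra \<Rightarrow> 'y"
  where "free_eval g p =
    (\<Sum>w\<in>Poly_Mapping.keys p. Poly_Mapping.lookup p w *\<^sub>C prod_list (map g (letters w)))"

definition two_sided_ideal :: "'y::complex_algebra_1 set \<Rightarrow> 'y set"
  where "two_sided_ideal S = cspan {p * r * q | p r q. r \<in> S}"

definition presented_by :: "('x \<Rightarrow> 'y::complex_algebra_1) \<Rightarrow> 'x free_algebra set \<Rightarrow> bool"
  where "presented_by g S \<longleftrightarrow>
    surj (free_eval g) \<and> {p. free_eval g p = 0} = two_sided_ideal S"


section \<open>The Yangian\<close>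

datatype pm = Plus | Minus

fun pm_sign :: "pm \<Rightarrow> complex" where
  "pm_sign Plus = 1"
| "pm_sign Minus = -1"

datatype 'i yangian_gen = Gen_xi 'i nat | Gen_x pm 'i nat

abbreviation "free_xi i r \<equiv> free_var (Gen_xi i r)"
abbreviation "free_x \<epsilon> i r \<equiv> free_var (Gen_x \<epsilon> i r)"

text \<open>Each set below consists of the elements (left-hand side) - (right-hand side) of one family
  of defining relations.\<close>

definition yangian_relators ::
    "('i \<Rightarrow> 'i \<Rightarrow> int) \<Rightarrow> ('i \<Rightarrow> nat) \<Rightarrow> complex \<Rightarrow> 'i yangian_gen free_algebra set"
  where "yangian_relators a d hbar =
    {commutator (free_xi i r) (free_xi j s) | i j r s. True} \<union>
    {commutator (free_xi i 0) (free_x \<epsilon> j s)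
      - (pm_sign \<epsilon> * of_int (int (d i) * a i j)) *\<^sub>C free_x \<epsilon> j s | \<epsilon> i j s. True} \<union>
    {commutator (free_xi i (Suc r)) (free_x \<epsilon> j s) - commutator (free_xi i r) (free_x \<epsilon> j (Suc s))
      - (pm_sign \<epsilon> * hbar * (of_int (int (d i) * a i j) / 2)) *\<^sub>C
          (free_xi i r * free_x \<epsilon> j s + free_x \<epsilon> j s * free_xi i r) | \<epsilon> i j r s. True} \<union>
    {commutator (free_x \<epsilon> i (Suc r)) (free_x \<epsilon> j s) - commutator (free_x \<epsilon> i r) (free_x \<epsilon> j (Suc s))
      - (pm_sign \<epsilon> * hbar * (of_int (int (d i) * a i j) / 2)) *\<^sub>C
          (free_x \<epsilon> i r * free_x \<epsilon> j s + free_x \<epsilon> j s * free_x \<epsilon> i r) | \<epsilon> i j r s. True} \<union>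
    {commutator (free_x Plus i r) (free_x Minus j s) - (if i = j then free_xi i (r + s) else 0)
      | i j r s. True} \<union>
    {\<Sum>\<pi> | \<pi> permutes {..<m}.
        foldr (\<lambda>k. commutator (free_x \<epsilon> i (r (\<pi> k)))) [0..<m] (free_x \<epsilon> j s)
      | \<epsilon> i j m r s. i \<noteq> j \<and> int m = 1 - a i j}"

definition is_yangian ::
    "('i \<Rightarrow> 'i \<Rightarrow> int) \<Rightarrow> ('i \<Rightarrow> nat) \<Rightarrow> complex \<Rightarrow>
     ('i \<Rightarrow> nat \<Rightarrow> 'y::complex_algebra_1) \<Rightarrow> (pm \<Rightarrow> 'i \<Rightarrow> nat \<Rightarrow> 'y) \<Rightarrow> bool"
  where "is_yangian a d hbar \<xi> x \<longleftrightarrow>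
    presented_by (\<lambda>g. case g of Gen_xi i r \<Rightarrow> \<xi> i r | Gen_x \<epsilon> i r \<Rightarrow> x \<epsilon> i r) (yangian_relators a d hbar)"

text \<open>\<open>\<iota> : \<gg> \<rightarrow> Y\<close> is the restriction to \<open>\<gg>\<close> of the embedding of \<open>U(\<gg>)\<close>.\<close>

definition yangian_embedding ::
    "('g::complex_vector \<Rightarrow> 'g \<Rightarrow> 'g) \<Rightarrow> ('i \<Rightarrow> nat) \<Rightarrow> ('i \<Rightarrow> 'g) \<Rightarrow> ('i \<Rightarrow> 'g) \<Rightarrow> ('i \<Rightarrow> 'g) \<Rightarrow>
     ('i \<Rightarrow> nat \<Rightarrow> 'y::complex_algebra_1) \<Rightarrow> (pm \<Rightarrow> 'i \<Rightarrow> nat \<Rightarrow> 'y) \<Rightarrow> ('g \<Rightarrow> 'y) \<Rightarrow> bool"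
  where "yangian_embedding bracket d e h f \<xi> x \<iota> \<longleftrightarrow>
    clinear \<iota> \<and> (\<forall>y z. \<iota> (bracket y z) = commutator (\<iota> y) (\<iota> z)) \<and>
    (\<forall>i. \<iota> (e i) = complex_of_real (1 / sqrt (real (d i))) *\<^sub>C x Plus i 0) \<and>
    (\<forall>i. \<iota> (h i) = complex_of_real (1 / real (d i)) *\<^sub>C \<xi> i 0) \<and>
    (\<forall>i. \<iota> (f i) = complex_of_real (1 / sqrt (real (d i))) *\<^sub>C x Minus i 0)"

text \<open>Formal power series in this theory are in the variable \<open>u\<^sup>-\<^sup>1\<close> (or \<open>z\<^sup>-\<^sup>1\<close>).\<close>

definition xi_series :: "complex \<Rightarrow> ('i \<Rightarrow> nat \<Rightarrow> 'y::complex_algebra_1) \<Rightarrow> 'i \<Rightarrow> 'y fps"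
  where "xi_series hbar \<xi> i = Abs_fps (\<lambda>n. case n of 0 \<Rightarrow> 1 | Suc r \<Rightarrow> hbar *\<^sub>C \<xi> i r)"

text \<open>\<open>log F = \<Sum>\<^sub>k\<^sub>\<ge>\<^sub>1 (-1)\<^sup>k\<^sup>+\<^sup>1 (F - 1)\<^sup>k / k\<close> for a series \<open>F\<close> with constant term \<open>1\<close>; only \<open>k \<le> n\<close>
  contributes to the \<open>n\<close>-th coefficient.\<close>

definition log_series :: "'y::complex_algebra_1 fps \<Rightarrow> 'y fps"
  where "log_series F =
    Abs_fps (\<lambda>n. \<Sum>k = 1..n. ((-1) ^ (k + 1) / of_nat k) *\<^sub>C fps_nth ((F - 1) ^ k) n)"

definition yangian_t :: "complex \<Rightarrow> ('i \<Rightarrow> nat \<Rightarrow> 'y::complex_algebra_1) \<Rightarrow> 'i \<Rightarrow> nat \<Rightarrow> 'y"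
  where "yangian_t hbar \<xi> i r = (1 / hbar) *\<^sub>C fps_nth (log_series (xi_series hbar \<xi> i)) (Suc r)"

definition yangian_coproduct ::
    "('g::complex_vector \<Rightarrow> 'g \<Rightarrow> 'g) \<Rightarrow> ('i::finite \<Rightarrow> 'i \<Rightarrow> int) \<Rightarrow> ('i \<Rightarrow> nat) \<Rightarrow> ('i \<Rightarrow> 'g) \<Rightarrow>
     (('i \<Rightarrow> int) \<Rightarrow> 'g) \<Rightarrow> (('i \<Rightarrow> int) \<Rightarrow> 'g) \<Rightarrow> complex \<Rightarrow>
     ('i \<Rightarrow> nat \<Rightarrow> 'y::complex_algebra_1) \<Rightarrow> ('g \<Rightarrow> 'y) \<Rightarrow> ('y \<Rightarrow> ('y, 'y) tensor) \<Rightarrow> bool"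
  where "yangian_coproduct bracket a d h xp xm hbar \<xi> \<iota> \<Delta> \<longleftrightarrow>
    algebra_hom \<Delta> \<and> (\<forall>y. \<Delta> (\<iota> y) = \<iota> y \<otimes>\<^sub>C 1 + 1 \<otimes>\<^sub>C \<iota> y) \<and>
    (\<forall>i. \<Delta> (yangian_t hbar \<xi> i 1) = yangian_t hbar \<xi> i 1 \<otimes>\<^sub>C 1 + 1 \<otimes>\<^sub>C yangian_t hbar \<xi> i 1
      - hbar *\<^sub>C (\<Sum>n\<in>positive_roots bracket a h.
          complex_of_int (\<Sum>j\<in>UNIV. n j * (int (d i) * a i j)) *\<^sub>C (\<iota> (xm n) \<otimes>\<^sub>C \<iota> (xp n))))"

text \<open>\<open>Y[z]\<close> is \<open>nat \<Rightarrow>\<^sub>0 Y\<close>, with \<open>Poly_Mapping.single k y\<close> standing for \<open>y z\<^sup>k\<close>.  Expanding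
  \<open>(u - z)\<^sup>-\<^sup>r\<^sup>-\<^sup>1 = \<Sum>\<^sub>s\<^sub>\<ge>\<^sub>r (s choose r) z\<^sup>s\<^sup>-\<^sup>r u\<^sup>-\<^sup>s\<^sup>-\<^sup>1\<close>, the substitution \<open>y(u) \<mapsto> y(u - z)\<close> sends the mode
  \<open>y\<^sub>s\<close> to \<open>\<Sum>\<^sub>r\<^sub>\<le>\<^sub>s (s choose r) y\<^sub>r z\<^sup>s\<^sup>-\<^sup>r\<close>.\<close>

definition shift_homomorphism ::
    "('i \<Rightarrow> nat \<Rightarrow> 'y::complex_algebra_1) \<Rightarrow> (pm \<Rightarrow> 'i \<Rightarrow> nat \<Rightarrow> 'y) \<Rightarrow> ('y \<Rightarrow> (nat \<Rightarrow>\<^sub>0 'y)) \<Rightarrow> bool"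
  where "shift_homomorphism \<xi> x \<theta> \<longleftrightarrow>
    algebra_hom \<theta> \<and>
    (\<forall>i s. \<theta> (\<xi> i s) = (\<Sum>r\<le>s. Poly_Mapping.single (s - r) (of_nat (s choose r) * \<xi> i r))) \<and>
    (\<forall>\<epsilon> i s. \<theta> (x \<epsilon> i s) = (\<Sum>r\<le>s. Poly_Mapping.single (s - r) (of_nat (s choose r) * x \<epsilon> i r)))"


section \<open>The universal R-matrix and lifted minors\<close>

definition fps_map :: "('a \<Rightarrow> 'b) \<Rightarrow> 'a fps \<Rightarrow> 'b fps"
  where "fps_map f F = Abs_fps (\<lambda>n. f (fps_nth F n))"

definition shift_left ::
    "('y::complex_algebra_1 \<Rightarrow> (nat \<Rightarrow>\<^sub>0 'y)) \<Rightarrow> ('y, 'y) tensor \<Rightarrow> (nat \<Rightarrow>\<^sub>0 ('y, 'y) tensor)"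
  where "shift_left \<theta> = tensor_lift (\<lambda>x y. Poly_Mapping.map (\<lambda>x'. x' \<otimes>\<^sub>C y) (\<theta> x))"

text \<open>The inclusion of \<open>W[z]\<close> into \<open>W((z\<^sup>-\<^sup>1))\<close>; the variable of the Laurent series is \<open>z\<^sup>-\<^sup>1\<close>.\<close>

definition poly_to_fls :: "(nat \<Rightarrow>\<^sub>0 'w::ring_1) \<Rightarrow> 'w fls"
  where "poly_to_fls p = (\<Sum>k\<in>Poly_Mapping.keys p. fls_const (Poly_Mapping.lookup p k) * fls_X_inv ^ k)"

definition leg12 :: "('y::complex_algebra_1, 'y) tensor \<Rightarrow> (('y, 'y) tensor, 'y) tensor"
  where "leg12 = tensor_lift (\<lambda>x y. (x \<otimes>\<^sub>C y) \<otimes>\<^sub>C 1)"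

definition leg13 :: "('y::complex_algebra_1, 'y) tensor \<Rightarrow> (('y, 'y) tensor, 'y) tensor"
  where "leg13 = tensor_lift (\<lambda>x y. (x \<otimes>\<^sub>C 1) \<otimes>\<^sub>C y)"

definition leg23 :: "('y::complex_algebra_1, 'y) tensor \<Rightarrow> (('y, 'y) tensor, 'y) tensor"
  where "leg23 = tensor_lift (\<lambda>x y. (1 \<otimes>\<^sub>C x) \<otimes>\<^sub>C y)"

definition universal_R_matrix ::
    "('y::complex_algebra_1 \<Rightarrow> ('y, 'y) tensor) \<Rightarrow> ('y \<Rightarrow> (nat \<Rightarrow>\<^sub>0 'y)) \<Rightarrow> ('y, 'y) tensor fps \<Rightarrow> bool"
  where "universal_R_matrix \<Delta> \<theta> R \<longleftrightarrow>
    fps_nth R 0 = 1 \<and>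
    (\<exists>R'. R * R' = 1 \<and> R' * R = 1 \<and>
      (\<forall>x. poly_to_fls (shift_left \<theta> (tensor_flip (\<Delta> x))) =
        fps_to_fls R * poly_to_fls (shift_left \<theta> (\<Delta> x)) * fps_to_fls R')) \<and>
    fps_map (tensor_map \<Delta> id) R = fps_map leg13 R * fps_map leg23 R \<and>
    fps_map (\<lambda>t. tensor_assoc (tensor_map id \<Delta> t)) R = fps_map leg13 R * fps_map leg12 R"

text \<open>The sign is the substitution \<open>z = -u\<close>.\<close>

definition transfer_operator ::
    "('y::complex_algebra_1, 'y) tensor fps \<Rightarrow> ('y \<Rightarrow> 'v::complex_vector cend) \<Rightarrow> ('v cend, 'y) tensor fps"
  where "transfer_operator R \<pi> =
    Abs_fps (\<lambda>n. (-1) ^ n *\<^sub>C tensor_map \<pi> id (tensor_flip (fps_nth R n)))"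

definition lifted_minor ::
    "('y::complex_algebra_1, 'y) tensor fps \<Rightarrow> ('y \<Rightarrow> 'v::complex_vector cend) \<Rightarrow> 'v cdual \<Rightarrow> 'v \<Rightarrow> 'y fps"
  where "lifted_minor R \<pi> \<phi> v =
    fps_map (\<lambda>T. tensor_lift (\<lambda>w y. cdual_apply \<phi> w *\<^sub>C y)
        (tensor_map (\<lambda>A. cend_apply A v) id T))
      (transfer_operator R \<pi>)"


section \<open>The operators tau\<close>

text \<open>\<open>exp(A) m\<close> for a locally nilpotent linear operator \<open>A\<close>: the index set is then finite.\<close>

definition locally_nilpotent_exp :: "('m::complex_vector \<Rightarrow> 'm) \<Rightarrow> 'm \<Rightarrow> 'm"
  where "locally_nilpotent_exp A m = (\<Sum>n | (A ^^ n) m \<noteq> 0. (1 / fact n) *\<^sub>C (A ^^ n) m)"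

definition tau :: "('g::complex_vector \<Rightarrow> 'm::complex_vector \<Rightarrow> 'm) \<Rightarrow> 'g \<Rightarrow> 'g \<Rightarrow> 'm \<Rightarrow> 'm"
  where "tau \<rho> e f m =
    locally_nilpotent_exp (\<rho> e) (locally_nilpotent_exp (\<rho> (- f)) (locally_nilpotent_exp (\<rho> e) m))"

definition act_adjoint :: "('g \<Rightarrow> 'y::complex_algebra_1) \<Rightarrow> 'g \<Rightarrow> 'y \<Rightarrow> 'y"
  where "act_adjoint \<iota> x y = commutator (\<iota> x) y"

definition act_module :: "('g \<Rightarrow> 'y) \<Rightarrow> ('y \<Rightarrow> 'v::complex_vector cend) \<Rightarrow> 'g \<Rightarrow> 'v \<Rightarrow> 'v"
  where "act_module \<iota> \<pi> x v = cend_apply (\<pi> (\<iota> x)) v"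

definition act_dual :: "('g \<Rightarrow> 'y) \<Rightarrow> ('y \<Rightarrow> 'v::complex_vector cend) \<Rightarrow> 'g \<Rightarrow> 'v cdual \<Rightarrow> 'v cdual"
  where "act_dual \<iota> \<pi> x \<phi> = contragredient (\<pi> (\<iota> x)) \<phi>"

end

theory Submission
  imports Defs
begin

text \<open>
  Both identities express one fact: the lifted minor is a \<open>\<gg>\<close>-equivariant function of
  \<open>(\<phi>, v)\<close>.

  For \<open>y \<in> \<gg>\<close>, the element \<open>D = y \<otimes> 1 + 1 \<otimes> y\<close> of \<open>Y \<otimes> Y\<close> is the coproduct of \<open>y\<close>.  It is symmetric
  under the flip, and the shift homomorphism does not change it, so the intertwining property of
  the R-matrix says that every coefficient \<open>t\<close> of \<open>R(z)\<close> commutes with \<open>D\<close>.  Rewriting \<open>[D, t] = 0\<close>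
  as \<open>[y \<otimes> 1, t] = t (1 \<otimes> y) - (1 \<otimes> y) t\<close> and applying the map \<open>a \<otimes> b \<mapsto> \<phi>(\<pi>(b) v) a\<close>, which
  produces the coefficients of the lifted minor, gives the formula for the adjoint action of \<open>y\<close>
  (\<open>R_matrix_commutes_with_primitive\<close>, \<open>commutator_matrix_coefficient\<close>).

  That the shift homomorphism fixes \<open>y\<close> is immediate from its formula only for the generators
  \<open>e\<^sub>i, f\<^sub>i\<close>.  It follows for all of \<open>\<gg>\<close> because these generate \<open>\<gg>\<close>
  (\<open>generated_by_chevalley_generators\<close>).  Generation is derived from simplicity by a trace
  argument: if \<open>K\<close> is a proper subspace containing the \<open>e\<^sub>i\<close> and stable under all
  \<open>ad e\<^sub>i, ad f\<^sub>i\<close>, then some positive or some negative roots survive in \<open>\<gg>/K\<close>.  The surviving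
  positive part is stable under \<open>e\<^sub>i\<close> and \<open>f\<^sub>i\<close>, because \<open>K\<close> contains the Cartan subalgebra; hence
  \<open>h\<^sub>i = [e\<^sub>i, f\<^sub>i]\<close> has trace zero on it, and the sum of the surviving positive roots vanishes on
  every \<open>h\<^sub>i\<close>.  A nonzero integral combination of the simple roots cannot do that, since the Cartan
  matrix is nonsingular.  The same applies to the negative part.

  The formula for \<open>\<tau>\<^sub>i\<close> is the exponentiated form of the formula for the adjoint action.  If
  \<open>A (L \<phi> v) = L (Z \<phi>) v + L \<phi> (X v)\<close> for a bilinear \<open>L\<close> and \<open>X\<close>, \<open>Z\<close> are nilpotent, then
  \<open>exp A (L \<phi> v) = L (exp Z \<phi>) (exp X v)\<close> (\<open>locally_nilpotent_exp_bilinear\<close>).  Here the elements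
  \<open>e\<^sub>i\<close> and \<open>f\<^sub>i\<close> act nilpotently on \<open>V\<close> because they are eigenvectors of \<open>ad h\<^sub>i\<close> with nonzero
  eigenvalues (\<open>eigen_operator_nilpotent\<close>).  Through the same formula, the coefficients of
  lifted minors inherit from \<open>V\<close> the local nilpotency of \<open>ad e\<^sub>i\<close> and \<open>ad f\<^sub>i\<close>.
\<close>

section \<open>Exponentials of derivations\<close>

lemma clinear_sum:
  fixes F :: "'a::complex_vector \<Rightarrow> 'b::complex_vector"
  assumes "clinear F"
  shows "F (sum g S) = (\<Sum>k\<in>S. F (g k))"
  by (induction S rule: infinite_finite_induct)
    (simp_all add: clinear_zero[OF assms] clinear_add[OF assms])

lemma funpow_vanishes_mono:
  fixes A :: "'a::zero \<Rightarrow> 'a"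
  assumes "A 0 = 0" and "(A ^^ N) m = 0" and "N \<le> n"
  shows "(A ^^ n) m = 0"
  using assms(3) by (induction n rule: dec_induct) (simp_all add: assms)

lemma locally_nilpotent_exp_eq_sum:
  assumes "A 0 = 0" and "(A ^^ N) m = 0"
  shows "locally_nilpotent_exp A m = (\<Sum>n<N. (1 / fact n) *\<^sub>C (A ^^ n) m)"
  unfolding locally_nilpotent_exp_def
proof (rule sum.mono_neutral_left)
  show "{n. (A ^^ n) m \<noteq> 0} \<subseteq> {..<N}"
    using funpow_vanishes_mono[OF assms] by (force simp: not_less[symmetric])
qed auto

text \<open>The Leibniz rule for powers.  Dividing by factorials turns the binomial coefficients into the
  weights of a product of two exponential series, which is the form summed below.\<close>

lemma bilinear_leibniz_power:
  fixes L :: "'a::complex_vector \<Rightarrow> 'b::complex_vector \<Rightarrow> 'c::complex_vector"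
  assumes A: "clinear A"
    and leibniz: "\<And>p v. A (L p v) = L (Z p) v + L p (X v)"
  shows "(1 / fact n) *\<^sub>C (A ^^ n) (L p v) =
    (\<Sum>k\<le>n. (1 / (fact k * fact (n - k))) *\<^sub>C L ((Z ^^ k) p) ((X ^^ (n - k)) v))"
proof (induction n)
  case 0
  show ?case by simp
next
  case (Suc n)
  \<comment> \<open>Applying \<open>A\<close> moves the summand \<open>(k, l)\<close> to \<open>(k + 1, l)\<close> and \<open>(k, l + 1)\<close>.  The two weights that
    then meet at one place of degree \<open>n + 1\<close> are \<open>k\<close> and \<open>n + 1 - k\<close> times the new weight, so they
    add up to \<open>n + 1\<close> times it.\<close>
  define t where "t k l = L ((Z ^^ k) p) ((X ^^ l) v)" for k l
  define c :: "nat \<Rightarrow> nat \<Rightarrow> complex" where "c k l = 1 / (fact k * fact l)" for k l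
  have At: "A (t k l) = t (Suc k) l + t k (Suc l)" for k l
    by (simp add: t_def leibniz)
  have IH: "(1 / fact n) *\<^sub>C (A ^^ n) (L p v) = (\<Sum>k\<le>n. c k (n - k) *\<^sub>C t k (n - k))"
    using Suc by (simp add: c_def t_def)
  have c1: "of_nat (Suc k) * c (Suc k) l = c k l" for k l
    by (simp add: c_def del: of_nat_Suc)
  have c2: "of_nat (Suc l) * c k (Suc l) = c k l" for k l
    by (simp add: c_def del: of_nat_Suc)
  have "(1 / fact n) *\<^sub>C (A ^^ Suc n) (L p v)
      = (\<Sum>k\<le>n. c k (n - k) *\<^sub>C t (Suc k) (n - k)) + (\<Sum>k\<le>n. c k (n - k) *\<^sub>C t k (Suc n - k))"
  proof -
    have "(1 / fact n) *\<^sub>C (A ^^ Suc n) (L p v) = A ((1 / fact n) *\<^sub>C (A ^^ n) (L p v))"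
      by (simp add: clinear_scale[OF A])
    also have "\<dots> = (\<Sum>k\<le>n. c k (n - k) *\<^sub>C (t (Suc k) (n - k) + t k (Suc (n - k))))"
      by (simp only: IH clinear_sum[OF A] clinear_scale[OF A] At)
    finally show ?thesis
      by (simp add: scaleC_add_right sum.distrib Suc_diff_le)
  qed
  also have "(\<Sum>k\<le>n. c k (n - k) *\<^sub>C t (Suc k) (n - k))
      = (\<Sum>k\<le>Suc n. (of_nat k * c k (Suc n - k)) *\<^sub>C t k (Suc n - k))"
    by (subst sum.atMost_Suc_shift) (simp add: c1 del: of_nat_Suc)
  also have "(\<Sum>k\<le>n. c k (n - k) *\<^sub>C t k (Suc n - k))
      = (\<Sum>k\<le>Suc n. (of_nat (Suc n - k) * c k (Suc n - k)) *\<^sub>C t k (Suc n - k))"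
    unfolding sum.atMost_Suc by (simp add: Suc_diff_le c2 del: of_nat_Suc of_nat_diff)
  also have "(\<Sum>k\<le>Suc n. (of_nat k * c k (Suc n - k)) *\<^sub>C t k (Suc n - k))
        + (\<Sum>k\<le>Suc n. (of_nat (Suc n - k) * c k (Suc n - k)) *\<^sub>C t k (Suc n - k))
      = (\<Sum>k\<le>Suc n. (of_nat (Suc n) * c k (Suc n - k)) *\<^sub>C t k (Suc n - k))"
    unfolding sum.distrib[symmetric] scaleC_add_left[symmetric] distrib_right[symmetric]
      of_nat_add[symmetric]
    by (rule sum.cong) auto
  also have "\<dots> = of_nat (Suc n) *\<^sub>C (\<Sum>k\<le>Suc n. c k (Suc n - k) *\<^sub>C t k (Suc n - k))"
    by (simp only: complex_vector.scale_sum_right scaleC_scaleC)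
  finally have eq: "(1 / fact n) *\<^sub>C (A ^^ Suc n) (L p v) = \<dots>" .
  have "(1 / fact (Suc n)) *\<^sub>C (A ^^ Suc n) (L p v)
      = (1 / of_nat (Suc n)) *\<^sub>C (1 / fact n) *\<^sub>C (A ^^ Suc n) (L p v)"
    by (simp add: scaleC_scaleC mult.commute del: of_nat_Suc)
  also have "\<dots> = (\<Sum>k\<le>Suc n. c k (Suc n - k) *\<^sub>C t k (Suc n - k))"
    unfolding eq by (simp add: scaleC_scaleC scaleC_one del: of_nat_Suc sum.atMost_Suc)
  finally show ?case by (simp only: c_def t_def)
qed

text \<open>An exponentiated derivation is multiplicative.  The operator \<open>A\<close> is nilpotent on \<open>L p v\<close>,
  because in degree \<open>M + N\<close> each term of the Leibniz rule applies \<open>Z\<close> at least \<open>M\<close> times or \<open>X\<close>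
  at least \<open>N\<close> times.\<close>

lemma locally_nilpotent_exp_bilinear:
  fixes L :: "'a::complex_vector \<Rightarrow> 'b::complex_vector \<Rightarrow> 'c::complex_vector"
  assumes L: "cbilinear L" and A: "clinear A"
    and leibniz: "\<And>p v. A (L p v) = L (Z p) v + L p (X v)"
    and Z: "Z 0 = 0" "(Z ^^ M) p = 0" and X: "X 0 = 0" "(X ^^ N) v = 0"
  shows "locally_nilpotent_exp A (L p v)
    = L (locally_nilpotent_exp Z p) (locally_nilpotent_exp X v)"
proof -
  have L_left: "clinear (\<lambda>p. L p v)" and L_right: "clinear (L p)" for p v
    using L by (simp_all add: cbilinear_def)
  define g where "g k l = (1 / (fact k * fact l)) *\<^sub>C L ((Z ^^ k) p) ((X ^^ l) v)" for k l
  have g0: "g k l = 0" if "M \<le> k \<or> N \<le> l" for k l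
    using that by (auto simp: g_def funpow_vanishes_mono[OF Z] funpow_vanishes_mono[OF X]
        clinear_zero[OF L_left] clinear_zero[OF L_right])
  have power: "(1 / fact n) *\<^sub>C (A ^^ n) (L p v) = (\<Sum>k\<le>n. g k (n - k))" for n
    unfolding g_def by (rule bilinear_leibniz_power[OF A]) (rule leibniz)
  have "(A ^^ (M + N)) (L p v) = 0"
  proof -
    have "(1 / fact (M + N)) *\<^sub>C (A ^^ (M + N)) (L p v) = (\<Sum>k\<le>M + N. g k (M + N - k))"
      by (rule power)
    also have "\<dots> = 0" by (rule sum.neutral) (auto intro!: g0)
    finally show ?thesis by (simp add: complex_vector.scale_eq_0_iff)
  qed
  then have "locally_nilpotent_exp A (L p v) = (\<Sum>n<M + N. \<Sum>k\<le>n. g k (n - k))"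
    by (simp add: locally_nilpotent_exp_eq_sum clinear_zero[OF A] power)
  also have "\<dots> = (\<Sum>(k, l) | k + l < M + N. g k l)"
    by (rule sum.triangle_reindex[symmetric])
  \<comment> \<open>The rectangle lies in the triangle, and \<open>g\<close> vanishes on the rest of the triangle.\<close>
  also have "\<dots> = (\<Sum>(k, l)\<in>{..<M} \<times> {..<N}. g k l)"
  proof (rule sum.mono_neutral_right)
    have "{(k, l). k + l < M + N} \<subseteq> {..<M + N} \<times> {..<M + N}" by auto
    then show "finite {(k, l). k + l < M + N}" by (rule finite_subset) simp
  qed (auto intro: g0 simp: not_less)
  also have "\<dots> = (\<Sum>k<M. \<Sum>l<N. g k l)"
    by (simp add: sum.cartesian_product)
  also have "\<dots> = L (\<Sum>k<M. (1 / fact k) *\<^sub>C (Z ^^ k) p) (\<Sum>l<N. (1 / fact l) *\<^sub>C (X ^^ l) v)"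
    by (simp only: g_def clinear_sum[OF L_left] clinear_scale[OF L_left])
      (simp add: clinear_sum[OF L_right] clinear_scale[OF L_right] complex_vector.scale_sum_right
        scaleC_scaleC)
  also have "\<dots> = L (locally_nilpotent_exp Z p) (locally_nilpotent_exp X v)"
    by (simp only: locally_nilpotent_exp_eq_sum[OF Z] locally_nilpotent_exp_eq_sum[OF X])
  finally show ?thesis .
qed

section \<open>Nilpotency of eigenvectors of an inner derivation\<close>

lemma eigenvectors_sum_zero:
  fixes x :: "nat \<Rightarrow> 'w::complex_vector"
  assumes T: "clinear T" and eigen: "\<And>n. T (x n) = (of_nat n * c) *\<^sub>C x n"
    and c: "c \<noteq> 0" and nonzero: "\<And>n. x n \<noteq> 0"
    and "finite A" and "(\<Sum>n\<in>A. u n *\<^sub>C x n) = 0" and "n \<in> A"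
  shows "u n = 0"
  using assms(5-)
proof (induction A arbitrary: u n rule: finite_induct)
  case (insert m A)
  \<comment> \<open>The operator \<open>T - m c\<close> kills the summand with index \<open>m\<close> and only rescales the others.\<close>
  have "(\<Sum>n\<in>A. (u n * ((of_nat n - of_nat m) * c)) *\<^sub>C x n)
      = T (\<Sum>n\<in>insert m A. u n *\<^sub>C x n) - (of_nat m * c) *\<^sub>C (\<Sum>n\<in>insert m A. u n *\<^sub>C x n)"
    using insert.hyps
    by (simp add: clinear_sum[OF T] clinear_scale[OF T] clinear_add[OF T] eigen scaleC_scaleC
        complex_vector.scale_sum_right scaleC_add_right complex_vector.scale_left_diff_distrib
        algebra_simps sum_subtractf)
  also have "\<dots> = 0" unfolding insert.prems(1) by (simp add: clinear_zero[OF T])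
  finally have "u n * ((of_nat n - of_nat m) * c) = 0" if "n \<in> A" for n
    using insert.IH[of "\<lambda>n. u n * ((of_nat n - of_nat m) * c)"] that by blast
  then have A0: "u n = 0" if "n \<in> A" for n
    using that c insert.hyps by (metis mult_eq_0_iff of_nat_eq_iff right_minus_eq)
  then have "u m *\<^sub>C x m = 0"
    using insert.prems(1) insert.hyps by simp
  then show ?case
    using A0 insert.prems(2) nonzero by (auto simp: complex_vector.scale_eq_0_iff)
qed simp

text \<open>The multiples \<open>0, c, 2c, \<dots>\<close> are distinct eigenvalues, and eigenvectors to distinct eigenvalues
  are independent; a finite-dimensional space has no room for infinitely many of them.\<close>

lemma eigenvector_sequence_vanishes:
  fixes x :: "nat \<Rightarrow> 'w::complex_vector"
  assumes fin: "finite S" "cspan S = (UNIV :: 'w set)"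
    and T: "clinear T" and eigen: "\<And>n. T (x n) = (of_nat n * c) *\<^sub>C x n"
    and c: "c \<noteq> 0"
  shows "\<exists>n. x n = 0"
proof (rule ccontr)
  assume "\<not> ?thesis"
  then have nonzero: "x n \<noteq> 0" for n by blast
  note sum_zero = eigenvectors_sum_zero[OF T eigen c nonzero]
  have inj: "inj x"
  proof (rule injI, rule ccontr)
    fix m n assume "x m = x n" "m \<noteq> n"
    then have "(\<Sum>k\<in>{m, n}. (if k = m then 1 else - 1) *\<^sub>C x k) = 0"
      by (simp add: scaleC_add_left[symmetric])
    from sum_zero[OF _ this, of m] show False by simp
  qed
  let ?X = "x ` {..card S}"
  have "\<not> cdependent ?X"
  proof (rule complex_vector.independent_if_scalars_zero)
    fix u y assume "(\<Sum>y\<in>?X. u y *\<^sub>C y) = 0" and y: "y \<in> ?X"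
    then have "(\<Sum>n\<le>card S. u (x n) *\<^sub>C x n) = 0"
      using inj by (simp add: sum.reindex inj_on_subset[of x UNIV])
    from sum_zero[OF _ this] y show "u y = 0" by auto
  qed simp
  then have "card ?X \<le> card S"
    using complex_vector.independent_span_bound[OF fin(1)] fin(2) by blast
  then show False using inj by (simp add: card_image inj_on_subset[of x UNIV])
qed

lemma finite_dimensional_cend:
  assumes "\<exists>S :: 'v::complex_vector set. finite S \<and> cspan S = UNIV"
  shows "\<exists>S :: 'v cend set. finite S \<and> cspan S = UNIV"
proof -
  obtain S :: "'v set" where S: "finite S" "cspan S = UNIV" using assms by blast
  obtain B where B: "B \<subseteq> S" "\<not> cdependent B" "S \<subseteq> cspan B"
    using complex_vector.maximal_independent_subset[of S] by blast
  have span_B: "cspan B = UNIV"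
    using complex_vector.span_mono[OF B(3)] S(2) by (auto simp: complex_vector.span_span)
  have fin_B: "finite B" using B(1) S(1) by (rule finite_subset)
  let ?r = "complex_vector.representation B"
  \<comment> \<open>The matrix units with respect to the basis \<open>B\<close>.\<close>
  define E where "E s t = Abs_cend (\<lambda>v. ?r v s *\<^sub>C t)" for s t
  have E_apply: "cend_apply (E s t) v = ?r v s *\<^sub>C t" for s t v
    unfolding E_def
    by (subst Abs_cend_inverse)
      (auto intro!: clinearI simp: complex_vector.representation_add[OF B(2)]
        complex_vector.representation_scale[OF B(2)] span_B scaleC_add_left scaleC_scaleC)
  have expand: "v = (\<Sum>b\<in>B. ?r v b *\<^sub>C b)" for v
    using complex_vector.sum_representation_eq[OF B(2) _ fin_B subset_refl, of v] span_B by simp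
  have apply_sum: "cend_apply (sum g I) v = (\<Sum>i\<in>I. cend_apply (g i) v)"
    for g :: "'v \<Rightarrow> 'v cend" and I v
    by (induction I rule: infinite_finite_induct)
      (simp_all add: zero_cend.rep_eq plus_cend.rep_eq)
  have "A \<in> cspan ((\<lambda>(s, t). E s t) ` (B \<times> B))" for A
  proof -
    have "A = (\<Sum>s\<in>B. \<Sum>t\<in>B. ?r (cend_apply A s) t *\<^sub>C E s t)"
    proof (rule cend_apply_inject[THEN iffD1], rule ext)
      fix v
      have "cend_apply A v = (\<Sum>s\<in>B. ?r v s *\<^sub>C cend_apply A s)"
        using cend_apply[of A]
        by (subst expand[of v]) (simp add: clinear_sum[of "cend_apply A"] clinear_scale[of "cend_apply A"])
      also have "\<dots> = (\<Sum>s\<in>B. ?r v s *\<^sub>C (\<Sum>t\<in>B. ?r (cend_apply A s) t *\<^sub>C t))"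
        by (simp flip: expand)
      finally show "cend_apply A v
          = cend_apply (\<Sum>s\<in>B. \<Sum>t\<in>B. ?r (cend_apply A s) t *\<^sub>C E s t) v"
        by (simp add: apply_sum scaleC_cend.rep_eq E_apply complex_vector.scale_sum_right
            scaleC_scaleC mult.commute)
    qed
    moreover have "\<dots> \<in> cspan ((\<lambda>(s, t). E s t) ` (B \<times> B))"
      by (intro complex_vector.span_sum complex_vector.span_scale complex_vector.span_base) auto
    ultimately show ?thesis by simp
  qed
  with fin_B show ?thesis
    by (intro exI[of _ "(\<lambda>(s, t). E s t) ` (B \<times> B)"]) auto
qed

lemma clinear_commutator: "clinear (commutator x)" for x :: "'a::complex_algebra"
  by (rule clinearI)
    (simp_all add: commutator_def algebra_simps mult_scaleC_left mult_scaleC_right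
      complex_vector.scale_right_diff_distrib)

text \<open>The powers of \<open>E\<close> are eigenvectors of the derivation \<open>[H, -]\<close> of \<open>End V\<close> to the eigenvalues \<open>n c\<close>,
  so one of them vanishes in the finite-dimensional space \<open>End V\<close>.\<close>

lemma eigen_operator_nilpotent:
  fixes E H :: "'v::complex_vector cend"
  assumes fin: "\<exists>S :: 'v set. finite S \<and> cspan S = UNIV"
    and eigen: "commutator H E = c *\<^sub>C E" and c: "c \<noteq> 0"
  shows "\<exists>n. E ^ n = 0"
proof -
  obtain S :: "'v cend set" where "finite S" "cspan S = UNIV"
    using finite_dimensional_cend[OF fin] by blast
  moreover have "clinear (commutator H)" by (rule clinear_commutator)
  moreover have "commutator H (E ^ n) = (of_nat n * c) *\<^sub>C E ^ n" for n
  proof (induction n)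
    case (Suc n)
    have "commutator H (E ^ Suc n) = commutator H E * E ^ n + E * commutator H (E ^ n)"
      by (simp add: commutator_def algebra_simps)
    then show ?case
      by (simp add: Suc eigen mult_scaleC_left mult_scaleC_right algebra_simps
          flip: scaleC_add_left)
  qed (simp add: commutator_def)
  ultimately show ?thesis
    using eigenvector_sequence_vanishes[of S "commutator H" "\<lambda>n. E ^ n" c] c by blast
qed

section \<open>Generation of a simple Lie algebra by its Chevalley generators\<close>

context lie_algebra
begin

lemma clinear_bracket_right: "clinear (bracket x)"
  and clinear_bracket_left: "clinear (\<lambda>x. bracket x y)"
  using bilinear by (simp_all add: cbilinear_def)

lemma bracket_antisym: "bracket x y = - bracket y x"
proof -
  have "bracket (x + y) (x + y) = bracket x x + bracket y x + (bracket x y + bracket y y)"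
    by (simp only: clinear_add[OF clinear_bracket_right] clinear_add[OF clinear_bracket_left])
  then show ?thesis by (simp add: alternating eq_neg_iff_add_eq_0 add.commute)
qed

lemma bracket_derivation:
  "bracket x (bracket y z) = bracket (bracket x y) z + bracket y (bracket x z)"
proof -
  have "bracket x (bracket y z) = - bracket y (bracket z x) - bracket z (bracket x y)"
    using jacobi[of x y z]
    by (simp add: eq_neg_iff_add_eq_0 diff_conv_add_uminus[symmetric] algebra_simps)
  moreover have "bracket z x = - bracket x z" "bracket z (bracket x y) = - bracket (bracket x y) z"
    by (rule bracket_antisym)+
  moreover have "bracket y (- w) = - bracket y w" for w
    using clinear_diff[OF clinear_bracket_right, of y 0 w]
    by (simp add: clinear_zero[OF clinear_bracket_right])
  ultimately show ?thesis by simp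
qed

end

lemma (in simple_lie_algebra) center_trivial:
  assumes "\<And>y. bracket z y = 0"
  shows "z = 0"
proof -
  let ?J = "{z. \<forall>y. bracket z y = 0}"
  have "csubspace ?J"
    by (rule complex_vector.subspaceI)
      (simp_all add: clinear_zero[OF clinear_bracket_left] clinear_add[OF clinear_bracket_left]
        clinear_scale[OF clinear_bracket_left])
  moreover have "\<forall>x. \<forall>z\<in>?J. bracket x z \<in> ?J"
  proof (intro allI ballI)
    fix x z assume "z \<in> ?J"
    then have "bracket z x = 0" by blast
    with bracket_antisym[of x z] have "bracket x z = 0" by simp
    then show "bracket x z \<in> ?J" by (simp add: clinear_zero[OF clinear_bracket_left])
  qed
  ultimately have "?J = {0} \<or> ?J = UNIV" by (rule no_proper_ideals)
  with nonabelian assms show ?thesis by auto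
qed

text \<open>The value of the root lattice element \<open>n\<close> on the coroot \<open>h\<^sub>i\<close>.\<close>

definition root_pairing :: "('i::finite \<Rightarrow> 'i \<Rightarrow> int) \<Rightarrow> ('i \<Rightarrow> int) \<Rightarrow> 'i \<Rightarrow> int"
  where "root_pairing a n i = (\<Sum>j\<in>UNIV. n j * a i j)"

definition simple_root :: "'i \<Rightarrow> 'i \<Rightarrow> int"
  where "simple_root i j = (if j = i then 1 else 0)"

lemma root_pairing_add: "root_pairing a (\<lambda>j. n j + m j) i = root_pairing a n i + root_pairing a m i"
  by (simp add: root_pairing_def distrib_right sum.distrib)

lemma root_pairing_diff: "root_pairing a (\<lambda>j. n j - m j) i = root_pairing a n i - root_pairing a m i"
  by (simp add: root_pairing_def left_diff_distrib sum_subtractf)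

lemma root_pairing_uminus: "root_pairing a (\<lambda>j. - n j) i = - root_pairing a n i"
  by (simp add: root_pairing_def sum_negf)

lemma root_pairing_simple_root: "root_pairing a (simple_root j) i = a i j"
  by (simp add: root_pairing_def simple_root_def if_distrib[of "\<lambda>c. c * _"] cong: if_cong)

context chevalley_generators
begin

abbreviation weight_space :: "('i \<Rightarrow> int) \<Rightarrow> 'g set"
  where "weight_space \<equiv> root_space bracket a h"

lemma weight_space_iff:
  "x \<in> weight_space n \<longleftrightarrow> (\<forall>i. bracket (h i) x = of_int (root_pairing a n i) *\<^sub>C x)"
  by (simp add: root_space_def root_pairing_def)

lemma bracket_weight_space:
  assumes "x \<in> weight_space n" "y \<in> weight_space m"
  shows "bracket x y \<in> weight_space (\<lambda>j. n j + m j)"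
  using assms
  by (simp add: weight_space_iff root_pairing_add bracket_derivation[of "h _" x y]
      clinear_scale[OF clinear_bracket_left] clinear_scale[OF clinear_bracket_right] scaleC_add_left)

lemma e_weight: "e i \<in> weight_space (simple_root i)"
  by (simp add: weight_space_iff root_pairing_simple_root bracket_h_e)

lemma f_weight: "f i \<in> weight_space (\<lambda>j. - simple_root i j)"
  by (simp add: weight_space_iff root_pairing_uminus root_pairing_simple_root bracket_h_f)

lemma h_weight: "h i \<in> weight_space (\<lambda>_. 0)"
  unfolding cartan_subalgebra by (rule complex_vector.span_base) simp

text \<open>Symmetrizability turns a vector \<open>n\<close> with \<open>a n = 0\<close> into the vector \<open>(d\<^sub>j n\<^sub>j)\<close> in the kernel of the
  transpose of \<open>a\<close>.  Then \<open>\<Sum>\<^sub>j d\<^sub>j n\<^sub>j h\<^sub>j\<close> is annihilated by all roots, so it is central and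
  therefore zero.\<close>

lemma cartan_matrix_nonsingular:
  assumes "symmetrizer a d" and n: "\<And>i. root_pairing a n i = 0"
  shows "n = (\<lambda>_. 0)"
proof -
  define z where "z = (\<Sum>j\<in>UNIV. of_int (int (d j) * n j) *\<^sub>C h j)"
  have sym: "int (d j) * a j k = int (d k) * a k j" and d: "d j > 0" for j k
    using assms(1) by (simp_all add: symmetrizer_def)
  have bracket_z: "bracket z y = (\<Sum>j\<in>UNIV. of_int (int (d j) * n j) *\<^sub>C bracket (h j) y)" for y
    by (simp add: z_def clinear_sum[OF clinear_bracket_left] clinear_scale[OF clinear_bracket_left])
  have "bracket z y = 0" if "y \<in> weight_space m" for y m
  proof -
    have "bracket z y = of_int (\<Sum>j\<in>UNIV. int (d j) * n j * root_pairing a m j) *\<^sub>C y"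
      using that
      by (simp add: bracket_z weight_space_iff scaleC_scaleC complex_vector.scale_sum_left)
    also have "(\<Sum>j\<in>UNIV. int (d j) * n j * root_pairing a m j)
        = (\<Sum>j\<in>UNIV. \<Sum>k\<in>UNIV. m k * n j * (int (d j) * a j k))"
      by (simp add: root_pairing_def sum_distrib_left mult_ac)
    also have "\<dots> = (\<Sum>k\<in>UNIV. \<Sum>j\<in>UNIV. m k * n j * (int (d k) * a k j))"
      by (subst sum.swap) (simp add: sym)
    also have "\<dots> = (\<Sum>k\<in>UNIV. int (d k) * m k * root_pairing a n k)"
      by (simp add: root_pairing_def sum_distrib_left mult_ac)
    finally show ?thesis by (simp add: n)
  qed
  then have "(\<Union>n\<in>{n. (\<forall>j. n j \<ge> 0) \<or> (\<forall>j. n j \<le> 0)}. weight_space n) \<subseteq> {y. bracket z y = 0}"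
    by blast
  moreover have "csubspace {y. bracket z y = 0}"
    by (rule complex_vector.subspaceI)
      (simp_all add: clinear_zero[OF clinear_bracket_right] clinear_add[OF clinear_bracket_right]
        clinear_scale[OF clinear_bracket_right])
  ultimately have "bracket z y = 0" for y
    using complex_vector.span_minimal root_decomposition by blast
  then have "z = 0" by (rule center_trivial)
  then have "(\<Sum>y\<in>range h. of_int (int (d (inv h y)) * n (inv h y)) *\<^sub>C y) = 0"
    using h_independent(1) by (simp add: z_def sum.reindex)
  then have "of_int (int (d j) * n j) = (0 :: complex)" for j
    using complex_vector.independentD[OF h_independent(2) _ subset_refl,
        of "\<lambda>y. of_int (int (d (inv h y)) * n (inv h y))" "h j"] h_independent(1)
    by simp
  then show ?thesis using d by (simp add: fun_eq_iff) (metis less_irrefl)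
qed

text \<open>The trace of \<open>h\<^sub>i = [e\<^sub>i, f\<^sub>i]\<close> on the positive part of \<open>\<gg>/K\<close> is zero, so the sum of the
  roots that occur there is zero, and there are none; likewise for the negative part.  The quotient
  is represented by a basis \<open>D\<close> of weight vectors that extends a basis \<open>C\<close> of the span of the weight
  vectors in \<open>K\<close>: this span is all of \<open>K\<close>, since \<open>K\<close> is stable under the \<open>h\<^sub>i\<close>, and
  the members of \<open>D - C\<close> stand for a basis of the quotient.\<close>

theorem generated_by_chevalley_generators:
  assumes sym: "symmetrizer a d"
    and K: "csubspace K" and eK: "\<And>i. e i \<in> K"
    and stable: "\<And>i x. x \<in> K \<Longrightarrow> bracket (e i) x \<in> K" "\<And>i x. x \<in> K \<Longrightarrow> bracket (f i) x \<in> K"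
  shows "K = UNIV"
proof -
  have hK: "h i \<in> K" for i
    using complex_vector.subspace_neg[OF K stable(2)[OF eK[of i], of i]]
      bracket_antisym[of "e i" "f i"] by (simp add: bracket_e_f)
  define G where "G = K \<inter> (\<Union>n. weight_space n)"
  have eG: "bracket (e i) x \<in> G" and fG: "bracket (f i) x \<in> G" if "x \<in> G" for i x
    using that stable by (force simp: G_def intro: bracket_weight_space e_weight f_weight)+
  obtain C where C: "C \<subseteq> G" "\<not> cdependent C" "G \<subseteq> cspan C"
    using complex_vector.maximal_independent_subset[of G] by blast
  let ?S = "\<Union>n\<in>{n. (\<forall>j. n j \<ge> 0) \<or> (\<forall>j. n j \<le> 0)}. weight_space n"
  obtain D where D: "C \<subseteq> D" "D \<subseteq> C \<union> ?S" "\<not> cdependent D" "C \<union> ?S \<subseteq> cspan D"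
    using complex_vector.maximal_independent_subset_extend[of C "C \<union> ?S"] C(2) by blast
  have span_D: "cspan D = UNIV"
    using complex_vector.span_mono[of ?S "cspan D"] D(4) root_decomposition
    by (auto simp: complex_vector.span_span)
  have fin_D: "finite D"
    using finite_dimensional complex_vector.independent_span_bound[OF _ D(3)] by blast
  have in_C: "b \<in> C" if "b \<in> D" "b \<in> cspan C" for b
    using that D(1,3) complex_vector.dependent_def complex_vector.span_mono[of C "D - {b}"] by blast
  have "\<exists>n. b \<in> weight_space n \<and> (b \<notin> C \<longrightarrow> (\<forall>j. n j \<ge> 0) \<or> (\<forall>j. n j \<le> 0))" if "b \<in> D" for b
  proof (cases "b \<in> C")
    case True
    then show ?thesis using C(1) by (auto simp: G_def)
  next
    case False
    then show ?thesis using that D(2) by blast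
  qed
  then obtain wt where wt: "b \<in> weight_space (wt b)"
    and semidefinite: "b \<notin> C \<Longrightarrow> (\<forall>j. wt b j \<ge> 0) \<or> (\<forall>j. wt b j \<le> 0)" if "b \<in> D" for b
    by metis

  \<comment> \<open>Coordinates with respect to \<open>D\<close>.\<close>
  define r where "r = complex_vector.representation D"
  have r_outside: "r x b = 0" if "b \<notin> D" for x b
    using that complex_vector.representation_ne_zero[of D x b] by (auto simp: r_def)
  have r_basis: "r c b = (if b = c then 1 else 0)" if "c \<in> D" for c b
    using that D(3) by (simp add: r_def complex_vector.representation_basis)
  have r_linear: "clinear (\<lambda>x. r x b)" for b
    by (rule clinearI)
      (simp_all add: r_def complex_vector.representation_add[OF D(3)] span_D
        complex_vector.representation_scale[OF D(3)])
  have expand: "x = (\<Sum>c\<in>D. r x c *\<^sub>C c)" for x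
    unfolding r_def
    by (rule complex_vector.sum_representation_eq[OF D(3) _ fin_D subset_refl, symmetric])
      (simp add: span_D)
  have r_compose: "r (T x) b = (\<Sum>c\<in>D. r x c * r (T c) b)" if T: "clinear T" for T x b
  proof -
    have comp: "clinear (\<lambda>x. r (T x) b)" by (rule clinear_composition[OF r_linear T])
    show ?thesis
      by (subst expand[of x]) (simp add: clinear_sum[OF comp] clinear_scale[OF comp])
  qed
  have r_G: "r x b = 0" if "x \<in> G" "b \<notin> C" for x b
  proof -
    have "r x = complex_vector.representation C x"
      unfolding r_def using that C(3) by (intro complex_vector.representation_extend[OF D(3) _ D(1)]) blast
    then show ?thesis
      using that complex_vector.representation_ne_zero[of C x b] by auto
  qed
  \<comment> \<open>Comparing coordinates of \<open>[h\<^sub>i, x]\<close> shows that a weight vector involves only basis vectors of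
    its own weight; here the weight is determined by its values on the \<open>h\<^sub>i\<close>, by nonsingularity.\<close>
  have r_weight: "wt b = n" if x: "x \<in> weight_space n" and b: "r x b \<noteq> 0" for x n b
  proof -
    have bD: "b \<in> D" using b r_outside by blast
    have "root_pairing a (wt b) i = root_pairing a n i" for i
    proof -
      have "of_int (root_pairing a n i) * r x b = r (bracket (h i) x) b"
        using x clinear_scale[OF r_linear] by (simp add: weight_space_iff)
      also have "\<dots> = (\<Sum>c\<in>D. r x c * r (bracket (h i) c) b)"
        by (rule r_compose[OF clinear_bracket_right])
      also have "\<dots> = (\<Sum>c\<in>D. if c = b then r x b * of_int (root_pairing a (wt b) i) else 0)"
      proof (rule sum.cong[OF refl])
        fix c assume c: "c \<in> D"
        then show "r x c * r (bracket (h i) c) b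
            = (if c = b then r x b * of_int (root_pairing a (wt b) i) else 0)"
          using wt[OF c] clinear_scale[OF r_linear] by (simp add: weight_space_iff r_basis)
      qed
      also have "\<dots> = r x b * of_int (root_pairing a (wt b) i)"
        using bD fin_D by simp
      finally show ?thesis using b by simp
    qed
    then have "root_pairing a (\<lambda>j. wt b j - n j) i = 0" for i
      by (simp add: root_pairing_diff)
    from cartan_matrix_nonsingular[OF sym this] show ?thesis by (auto simp: fun_eq_iff)
  qed

  \<comment> \<open>The height decides the sign of a root.  It is nonzero on \<open>D - C\<close>, because zero would be the only
    semidefinite weight of height zero and the span of \<open>C\<close> contains the Cartan subalgebra.\<close>
  define ht :: "('i \<Rightarrow> int) \<Rightarrow> int" where "ht n = (\<Sum>j\<in>UNIV. n j)" for n
  have ht_nonzero: "ht (wt b) \<noteq> 0" if b: "b \<in> D - C" for b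
  proof
    assume 0: "ht (wt b) = 0"
    have "(\<forall>j. wt b j \<ge> 0) \<or> (\<forall>j. wt b j \<le> 0)" using b semidefinite by blast
    then have "wt b = (\<lambda>_. 0)"
    proof
      assume "\<forall>j. wt b j \<ge> 0"
      then show ?thesis using 0 sum_nonneg_eq_0_iff[of UNIV "wt b"] by (simp add: ht_def fun_eq_iff)
    next
      assume "\<forall>j. wt b j \<le> 0"
      then show ?thesis
        using 0 sum_nonneg_eq_0_iff[of UNIV "\<lambda>j. - wt b j"] by (simp add: ht_def fun_eq_iff sum_negf)
    qed
    then have "b \<in> cspan (range h)" using wt[of b] b cartan_subalgebra by simp
    moreover have "h i \<in> G" for i unfolding G_def using hK h_weight by blast
    then have "range h \<subseteq> cspan C" using C(3) by blast
    ultimately have "b \<in> cspan C"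
      using complex_vector.span_minimal[OF _ complex_vector.subspace_span] by blast
    then show False using in_C b by blast
  qed
  have ht_simple: "ht (simple_root i) = 1" for i
    by (simp add: ht_def simple_root_def)

  \<comment> \<open>The sign \<open>s\<close> selects the positive or the negative part of the quotient.\<close>
  define P where "P s = {b \<in> D - C. s * ht (wt b) > 0}" for s :: int
  have fin_P: "finite (P s)" for s using fin_D by (simp add: P_def)
  \<comment> \<open>Operators of height \<open>1\<close> or \<open>-1\<close> cannot lead from one part to the other, since no height of
    \<open>D - C\<close> is zero; a detour through \<open>C\<close> does not
    return to \<open>D - C\<close>, since these operators preserve the span of \<open>C\<close>.\<close>
  have P_closed: "c \<in> P s"
    if b: "b \<in> P s" and c: "c \<in> D" "r (bracket X b) c \<noteq> 0" "r (bracket Y c) b \<noteq> 0"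
      and X: "X \<in> weight_space m" "\<bar>ht m\<bar> = 1" and Y: "\<And>x. x \<in> G \<Longrightarrow> bracket Y x \<in> G"
      and s: "\<bar>s\<bar> = 1"
    for b c X Y m s
  proof -
    have "wt c = (\<lambda>j. m j + wt b j)"
      using r_weight[OF bracket_weight_space[OF X(1) wt] c(2)] b by (simp add: P_def)
    then have "ht (wt c) = ht m + ht (wt b)" by (simp add: ht_def sum.distrib)
    moreover have cC: "c \<in> D - C"
      using c r_G[OF Y, of c b] C(1) b by (auto simp: P_def)
    ultimately show ?thesis
      using b X(2) s ht_nonzero[OF cC] unfolding P_def by (auto simp: abs_if split: if_splits)
  qed
  \<comment> \<open>So the diagonal entries of \<open>ad X ad Y\<close> on the part \<open>P s\<close> are those of a product of two
    \<open>P s \<times> P s\<close> matrices, and the trace of a product is symmetric in its factors.\<close>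
  have trace: "(\<Sum>b\<in>P s. r (bracket X (bracket Y b)) b)
      = (\<Sum>b\<in>P s. \<Sum>c\<in>P s. r (bracket Y b) c * r (bracket X c) b)"
    if X: "\<And>x. x \<in> G \<Longrightarrow> bracket X x \<in> G" and Y: "Y \<in> weight_space m" "\<bar>ht m\<bar> = 1" and s: "\<bar>s\<bar> = 1"
    for X Y m s
  proof (rule sum.cong[OF refl])
    fix b assume b: "b \<in> P s"
    have "r (bracket X (bracket Y b)) b = (\<Sum>c\<in>D. r (bracket Y b) c * r (bracket X c) b)"
      by (rule r_compose[OF clinear_bracket_right])
    also have "\<dots> = (\<Sum>c\<in>P s. r (bracket Y b) c * r (bracket X c) b)"
      using P_closed[OF b _ _ _ Y X s]
      by (intro sum.mono_neutral_right fin_D) (auto simp: P_def)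
    finally show "r (bracket X (bracket Y b)) b = \<dots>" .
  qed
  have P_empty: "P s = {}" if s: "\<bar>s\<bar> = 1" for s
  proof (rule ccontr)
    assume nonempty: "P s \<noteq> {}"
    have "root_pairing a (\<lambda>j. \<Sum>b\<in>P s. wt b j) i = 0" for i
    proof -
      have "complex_of_int (root_pairing a (\<lambda>j. \<Sum>b\<in>P s. wt b j) i)
          = of_int (\<Sum>b\<in>P s. root_pairing a (wt b) i)"
        unfolding root_pairing_def sum_distrib_right by (subst sum.swap) simp
      also have "\<dots> = (\<Sum>b\<in>P s. r (bracket (h i) b) b)"
        unfolding of_int_sum
      proof (rule sum.cong[OF refl])
        fix b assume "b \<in> P s"
        then have "b \<in> D" by (simp add: P_def)
        then show "of_int (root_pairing a (wt b) i) = r (bracket (h i) b) b"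
          using wt[of b] clinear_scale[OF r_linear] by (simp add: weight_space_iff r_basis)
      qed
      also have "\<dots> = (\<Sum>b\<in>P s. r (bracket (e i) (bracket (f i) b)) b)
          - (\<Sum>b\<in>P s. r (bracket (f i) (bracket (e i) b)) b)"
        using bracket_derivation[of "e i" "f i"]
        by (simp add: bracket_e_f clinear_add[OF r_linear] sum.distrib)
      also have "\<dots> = (\<Sum>b\<in>P s. \<Sum>c\<in>P s. r (bracket (f i) b) c * r (bracket (e i) c) b)
          - (\<Sum>b\<in>P s. \<Sum>c\<in>P s. r (bracket (e i) b) c * r (bracket (f i) c) b)"
        using trace[OF eG f_weight _ s] trace[OF fG e_weight _ s]
        by (simp add: ht_simple, simp add: ht_def sum_negf ht_simple[unfolded ht_def])
      also have "\<dots> = 0"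
        by (subst sum.swap) (simp add: mult.commute)
      finally show ?thesis by simp
    qed
    then have "(\<lambda>j. \<Sum>b\<in>P s. wt b j) = (\<lambda>_. 0)" by (rule cartan_matrix_nonsingular[OF sym])
    then have "(\<Sum>j\<in>UNIV. \<Sum>b\<in>P s. wt b j) = 0" by (simp add: fun_eq_iff)
    then have "(\<Sum>b\<in>P s. s * ht (wt b)) = 0"
      unfolding ht_def sum_distrib_left[symmetric] by (subst sum.swap) simp
    moreover have "(\<Sum>b\<in>P s. s * ht (wt b)) > 0"
      using nonempty fin_P by (intro sum_pos) (auto simp: P_def)
    ultimately show False by simp
  qed
  have "D \<subseteq> C"
  proof
    fix b assume "b \<in> D"
    show "b \<in> C"
    proof (rule ccontr)
      assume "b \<notin> C"
      then have "b \<in> P 1 \<or> b \<in> P (- 1)"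
        using \<open>b \<in> D\<close> ht_nonzero[of b] by (auto simp: P_def)
      then show False by (simp add: P_empty)
    qed
  qed
  then have "D \<subseteq> K" using C(1) by (auto simp: G_def)
  then show ?thesis using complex_vector.span_minimal[OF _ K] span_D by blast
qed

end

section \<open>Commutation of the R-matrix with primitive elements\<close>

lemma poly_to_fls_single: "poly_to_fls (Poly_Mapping.single 0 w) = fls_const w"
  by (cases "w = 0") (simp_all add: poly_to_fls_def)

lemma tens_zero_left: "0 \<otimes>\<^sub>C y = 0" and tens_zero_right: "x \<otimes>\<^sub>C 0 = 0"
  using tens_scaleC_left[of 0 0 y] tens_scaleC_right[of x 0 0] by simp_all

lemma
  fixes \<theta> :: "'a::complex_algebra_1 \<Rightarrow> (nat \<Rightarrow>\<^sub>0 'a)"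
  assumes "clinear \<theta>"
  shows shift_left_tens: "shift_left \<theta> (x \<otimes>\<^sub>C y) = Poly_Mapping.map (\<lambda>x'. x' \<otimes>\<^sub>C y) (\<theta> x)"
    and clinear_shift_left: "clinear (shift_left \<theta>)"
proof -
  have lookup_map: "Poly_Mapping.lookup (Poly_Mapping.map g p) k = g (Poly_Mapping.lookup p k)"
    if "g 0 = 0" for g :: "'a \<Rightarrow> ('a, 'a) tensor" and p :: "nat \<Rightarrow>\<^sub>0 'a" and k
    using that by (simp add: Poly_Mapping.map.rep_eq when_def)
  have bil: "cbilinear (\<lambda>x (y :: 'a). Poly_Mapping.map (\<lambda>x'. x' \<otimes>\<^sub>C y) (\<theta> x))"
    by (rule cbilinearI; rule poly_mapping_eqI)
      (simp_all add: lookup_map tens_zero_left lookup_add lookup_scaleC clinear_add[OF assms]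
        clinear_scale[OF assms] tens_add_left tens_add_right tens_scaleC_left tens_scaleC_right)
  show "shift_left \<theta> (x \<otimes>\<^sub>C y) = Poly_Mapping.map (\<lambda>x'. x' \<otimes>\<^sub>C y) (\<theta> x)"
    and "clinear (shift_left \<theta>)"
    unfolding shift_left_def
    by (rule tensor_lift_tens[OF bil], rule clinear_tensor_lift[OF bil])
qed

lemma tensor_flip_tens: "tensor_flip (x \<otimes>\<^sub>C y) = y \<otimes>\<^sub>C x"
  and clinear_tensor_flip: "clinear tensor_flip"
proof -
  have bil: "cbilinear (\<lambda>x y. y \<otimes>\<^sub>C x)"
    by (rule cbilinearI) (simp_all add: tens_add_left tens_add_right tens_scaleC_left tens_scaleC_right)
  show "tensor_flip (x \<otimes>\<^sub>C y) = y \<otimes>\<^sub>C x" and "clinear tensor_flip"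
    unfolding tensor_flip_def by (rule tensor_lift_tens[OF bil], rule clinear_tensor_lift[OF bil])
qed

lemma
  assumes "clinear f" "clinear g"
  shows tensor_map_tens: "tensor_map f g (x \<otimes>\<^sub>C y) = f x \<otimes>\<^sub>C g y"
    and clinear_tensor_map: "clinear (tensor_map f g)"
proof -
  have bil: "cbilinear (\<lambda>x y. f x \<otimes>\<^sub>C g y)"
    by (rule cbilinearI)
      (simp_all add: clinear_add[OF assms(1)] clinear_add[OF assms(2)] clinear_scale[OF assms(1)]
        clinear_scale[OF assms(2)] tens_add_left tens_add_right tens_scaleC_left tens_scaleC_right)
  show "tensor_map f g (x \<otimes>\<^sub>C y) = f x \<otimes>\<^sub>C g y" and "clinear (tensor_map f g)"
    unfolding tensor_map_def by (rule tensor_lift_tens[OF bil], rule clinear_tensor_lift[OF bil])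
qed

text \<open>A primitive element has a symmetric coproduct.  If the shift also fixes it, both sides of the
  intertwining relation involve the same element \<open>D\<close>, and the relation reads \<open>D R = R D\<close>.  As \<open>D\<close> is
  constant in \<open>z\<close>, this holds coefficient by coefficient.\<close>

lemma R_matrix_commutes_with_primitive:
  fixes R :: "('y::complex_algebra_1, 'y) tensor fps"
  assumes R: "universal_R_matrix \<Delta> \<theta> R" and \<theta>: "algebra_hom \<theta>"
    and prim: "\<Delta> p = p \<otimes>\<^sub>C 1 + 1 \<otimes>\<^sub>C p" and fixed: "\<theta> p = Poly_Mapping.single 0 p"
  shows "(p \<otimes>\<^sub>C 1 + 1 \<otimes>\<^sub>C p) * fps_nth R n = fps_nth R n * (p \<otimes>\<^sub>C 1 + 1 \<otimes>\<^sub>C p)"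
proof -
  let ?p = "p \<otimes>\<^sub>C 1 + 1 \<otimes>\<^sub>C p"
  have lin: "clinear \<theta>" and one: "\<theta> 1 = Poly_Mapping.single 0 1"
    using \<theta> by (simp_all add: algebra_hom_def)
  have flip: "tensor_flip (\<Delta> p) = \<Delta> p"
    by (simp add: prim clinear_add[OF clinear_tensor_flip] tensor_flip_tens add.commute)
  have "shift_left \<theta> (\<Delta> p) = Poly_Mapping.single 0 ?p"
    by (simp add: prim clinear_add[OF clinear_shift_left[OF lin]] shift_left_tens[OF lin]
        one fixed single_add tens_zero_left del: single_one)
  then have const: "poly_to_fls (shift_left \<theta> (\<Delta> p)) = fls_const ?p"
    by (simp only: poly_to_fls_single)
  obtain R' where R': "R' * R = 1"
    and inter: "\<forall>x. poly_to_fls (shift_left \<theta> (tensor_flip (\<Delta> x))) =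
        fps_to_fls R * poly_to_fls (shift_left \<theta> (\<Delta> x)) * fps_to_fls R'"
    using R unfolding universal_R_matrix_def by blast
  have "fls_const ?p = fps_to_fls R * fls_const ?p * fps_to_fls R'"
    using inter[rule_format, of p] by (simp only: flip const)
  then have "fps_to_fls (fps_const ?p) = fps_to_fls (R * fps_const ?p * R')"
    by (simp only: fps_const_to_fls fls_times_fps_to_fls)
  then have "fps_const ?p = R * fps_const ?p * R'" by (simp only: fps_to_fls_eq_iff)
  then have "fps_const ?p * R = R * fps_const ?p"
    by (metis R' mult.assoc mult.right_neutral)
  then have "fps_nth (fps_const ?p * R) n = fps_nth (R * fps_const ?p) n" by simp
  then show ?thesis by (simp only: fps_mult_left_const_nth fps_mult_right_const_nth)
qed

section \<open>Coefficients of lifted minors\<close>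

lemma clinear_cend_apply: "clinear (cend_apply A)" for A :: "'w::complex_vector cend"
  using cend_apply[of A] by simp

lemma clinear_cdual_apply: "clinear (cdual_apply \<phi>)" for \<phi> :: "'w::complex_vector cdual"
  using cdual_apply[of \<phi>] by simp

text \<open>A coefficient of a lifted minor as a function of the corresponding coefficient of \<open>R\<close>.  The flip
  in the transfer operator is absorbed: the second tensor leg acts on \<open>V\<close>, and the first remains in
  \<open>Y\<close>.\<close>

definition matrix_coefficient ::
    "('y::complex_algebra_1 \<Rightarrow> 'v::complex_vector cend) \<Rightarrow> 'v cdual \<Rightarrow> 'v \<Rightarrow> ('y, 'y) tensor \<Rightarrow> 'y"
  where "matrix_coefficient \<pi> \<phi> v = tensor_lift (\<lambda>x y. cdual_apply \<phi> (cend_apply (\<pi> y) v) *\<^sub>C x)"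

context
  fixes \<pi> :: "'y::complex_algebra_1 \<Rightarrow> 'v::complex_vector cend"
  assumes \<pi>: "algebra_hom \<pi>"
begin

lemma clinear_action: "clinear \<pi>"
  using \<pi> by (simp add: algebra_hom_def)

lemma action_mult: "cend_apply (\<pi> (x * y)) v = cend_apply (\<pi> x) (cend_apply (\<pi> y) v)"
  using \<pi> by (simp add: algebra_hom_def times_cend.rep_eq)

lemma cbilinear_matrix_coefficient:
  "cbilinear (\<lambda>x y. cdual_apply \<phi> (cend_apply (\<pi> y) v) *\<^sub>C (x :: 'y))"
  by (rule cbilinearI)
    (simp_all add: clinear_add[OF clinear_action] clinear_scale[OF clinear_action]
      plus_cend.rep_eq scaleC_cend.rep_eq clinear_add[OF clinear_cdual_apply]
      clinear_scale[OF clinear_cdual_apply] scaleC_add_left scaleC_add_right scaleC_scaleC mult.commute)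

lemma matrix_coefficient_tens:
  "matrix_coefficient \<pi> \<phi> v (x \<otimes>\<^sub>C y) = cdual_apply \<phi> (cend_apply (\<pi> y) v) *\<^sub>C x"
  unfolding matrix_coefficient_def by (rule tensor_lift_tens[OF cbilinear_matrix_coefficient])

lemma clinear_matrix_coefficient: "clinear (matrix_coefficient \<pi> \<phi> v)"
  unfolding matrix_coefficient_def by (rule clinear_tensor_lift[OF cbilinear_matrix_coefficient])

lemma matrix_coefficient_add: "matrix_coefficient \<pi> \<phi> v (s + t) = matrix_coefficient \<pi> \<phi> v s + matrix_coefficient \<pi> \<phi> v t"
  and matrix_coefficient_diff: "matrix_coefficient \<pi> \<phi> v (s - t) = matrix_coefficient \<pi> \<phi> v s - matrix_coefficient \<pi> \<phi> v t"
  and matrix_coefficient_zero: "matrix_coefficient \<pi> \<phi> v 0 = 0"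
  by (rule clinear_add[OF clinear_matrix_coefficient] clinear_diff[OF clinear_matrix_coefficient]
      clinear_zero[OF clinear_matrix_coefficient])+

lemma cbilinear_matrix_coefficient_args: "cbilinear (\<lambda>\<phi> v. matrix_coefficient \<pi> \<phi> v t)"
proof (induction t)
  case zero
  show ?case by (rule cbilinearI) (simp_all add: matrix_coefficient_zero)
next
  case (tens x y)
  show ?case
    by (rule cbilinearI)
      (simp_all add: matrix_coefficient_tens plus_cdual.rep_eq scaleC_cdual.rep_eq
        clinear_add[OF clinear_cend_apply] clinear_scale[OF clinear_cend_apply]
        clinear_add[OF clinear_cdual_apply] clinear_scale[OF clinear_cdual_apply]
        scaleC_add_left scaleC_scaleC)
next
  case (add s t)
  then show ?case
    by (simp add: matrix_coefficient_add cbilinear_def clinear_pointwise_add)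
qed

lemma matrix_coefficient_mult_left_leg:
  "p * matrix_coefficient \<pi> \<phi> v t = matrix_coefficient \<pi> \<phi> v ((p \<otimes>\<^sub>C 1) * t)"
  "matrix_coefficient \<pi> \<phi> v t * p = matrix_coefficient \<pi> \<phi> v (t * (p \<otimes>\<^sub>C 1))"
  by (induction t) (simp_all add: matrix_coefficient_zero matrix_coefficient_add
      matrix_coefficient_tens tens_times_tens distrib_left distrib_right
      mult_scaleC_left mult_scaleC_right)

lemma matrix_coefficient_mult_right_leg:
  "matrix_coefficient \<pi> \<phi> v (t * (1 \<otimes>\<^sub>C p)) = matrix_coefficient \<pi> \<phi> (cend_apply (\<pi> p) v) t"
  "matrix_coefficient \<pi> \<phi> v ((1 \<otimes>\<^sub>C p) * t) = - matrix_coefficient \<pi> (contragredient (\<pi> p) \<phi>) v t"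
  by (induction t) (simp_all add: matrix_coefficient_zero matrix_coefficient_add
      matrix_coefficient_tens tens_times_tens distrib_left distrib_right action_mult
      contragredient.rep_eq)

text \<open>Since \<open>t\<close> commutes with \<open>p \<otimes> 1 + 1 \<otimes> p\<close>, the commutator with \<open>p\<close> in the first leg can be traded for
  minus the commutator in the second leg, and there \<open>p\<close> acts on \<open>v\<close> from the right of \<open>t\<close> and on
  \<open>\<phi>\<close> from the left.\<close>

lemma commutator_matrix_coefficient:
  assumes "(p \<otimes>\<^sub>C 1 + 1 \<otimes>\<^sub>C p) * t = t * (p \<otimes>\<^sub>C 1 + 1 \<otimes>\<^sub>C p)"
  shows "commutator p (matrix_coefficient \<pi> \<phi> v t)
    = matrix_coefficient \<pi> (contragredient (\<pi> p) \<phi>) v t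
      + matrix_coefficient \<pi> \<phi> (cend_apply (\<pi> p) v) t"
proof -
  have "(p \<otimes>\<^sub>C 1) * t - t * (p \<otimes>\<^sub>C 1) = t * (1 \<otimes>\<^sub>C p) - (1 \<otimes>\<^sub>C p) * t"
    using assms by (simp add: algebra_simps)
  then have "commutator p (matrix_coefficient \<pi> \<phi> v t)
      = matrix_coefficient \<pi> \<phi> v (t * (1 \<otimes>\<^sub>C p)) - matrix_coefficient \<pi> \<phi> v ((1 \<otimes>\<^sub>C p) * t)"
    by (simp add: commutator_def matrix_coefficient_mult_left_leg flip: matrix_coefficient_diff)
  then show ?thesis by (simp add: matrix_coefficient_mult_right_leg)
qed

lemma lifted_minor_nth:
  "fps_nth (lifted_minor R \<pi> \<phi> v) n = matrix_coefficient \<pi> \<phi> v ((-1) ^ n *\<^sub>C fps_nth R n)"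
proof -
  have ev: "clinear (\<lambda>A. cend_apply A v)"
    by (rule clinearI) (simp_all add: plus_cend.rep_eq scaleC_cend.rep_eq)
  have id: "clinear (id :: 'y \<Rightarrow> 'y)" by (rule clinearI) simp_all
  have bil: "cbilinear (\<lambda>w (y :: 'y). cdual_apply \<phi> w *\<^sub>C y)"
    by (rule cbilinearI)
      (simp_all add: clinear_add[OF clinear_cdual_apply] clinear_scale[OF clinear_cdual_apply]
        scaleC_add_left scaleC_add_right scaleC_scaleC mult.commute)
  define L where "L T = tensor_lift (\<lambda>w y. cdual_apply \<phi> w *\<^sub>C y)
      (tensor_map (\<lambda>A. cend_apply A v) id T)" for T :: "('v cend, 'y) tensor"
  have L: "clinear L"
    unfolding L_def by (rule clinear_composition[OF clinear_tensor_lift[OF bil] clinear_tensor_map[OF ev id]])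
  have L_tens: "L (A \<otimes>\<^sub>C y) = cdual_apply \<phi> (cend_apply A v) *\<^sub>C y" for A y
    by (simp add: L_def tensor_map_tens[OF ev id] tensor_lift_tens[OF bil])
  define F where "F t = L (tensor_map \<pi> id (tensor_flip t))" for t
  have F: "clinear F"
    unfolding F_def
    by (rule clinear_composition[OF L clinear_composition[OF clinear_tensor_map[OF clinear_action id]
          clinear_tensor_flip]])
  have F_tens: "F (x \<otimes>\<^sub>C y) = matrix_coefficient \<pi> \<phi> v (x \<otimes>\<^sub>C y)" for x y
    unfolding F_def tensor_flip_tens tensor_map_tens[OF clinear_action id] L_tens
      matrix_coefficient_tens by simp
  have "F t = matrix_coefficient \<pi> \<phi> v t" for t
    by (induction t)
      (simp_all add: F_tens clinear_zero[OF F] clinear_add[OF F] matrix_coefficient_zero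
        matrix_coefficient_add)
  then show ?thesis
    by (simp add: lifted_minor_def fps_map_def transfer_operator_def F_def[symmetric] L_def[symmetric]
        clinear_scale[OF L] clinear_scale[OF clinear_matrix_coefficient])
qed

end

section \<open>The action of the Lie algebra on lifted minors\<close>

text \<open>The elements whose image in \<open>Y\<close> is fixed by the shift form a Lie subalgebra.  It contains the
  \<open>e\<^sub>i\<close> and \<open>f\<^sub>i\<close>, whose images are multiples of the generators of level zero.\<close>

lemma shift_fixes_lie_algebra:
  fixes \<theta> :: "'y::complex_algebra_1 \<Rightarrow> (nat \<Rightarrow>\<^sub>0 'y)"
  assumes "chevalley_generators bracket a e h f" and sym: "symmetrizer a d"
    and \<iota>: "yangian_embedding bracket d e h f \<xi> x \<iota>" and \<theta>: "shift_homomorphism \<xi> x \<theta>"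
  shows "\<theta> (\<iota> y) = Poly_Mapping.single 0 (\<iota> y)"
proof -
  interpret chevalley_generators bracket a e h f by fact
  have \<iota>_lin: "clinear \<iota>" and \<iota>_bracket: "\<iota> (bracket y z) = commutator (\<iota> y) (\<iota> z)"
    and \<iota>_e: "\<iota> (e i) = complex_of_real (1 / sqrt (real (d i))) *\<^sub>C x Plus i 0"
    and \<iota>_f: "\<iota> (f i) = complex_of_real (1 / sqrt (real (d i))) *\<^sub>C x Minus i 0" for y z i
    using \<iota> by (simp_all add: yangian_embedding_def)
  have \<theta>_lin: "clinear \<theta>" and \<theta>_mult: "\<theta> (p * q) = \<theta> p * \<theta> q"
    and \<theta>_x: "\<theta> (x \<epsilon> i 0) = Poly_Mapping.single 0 (x \<epsilon> i 0)" for p q \<epsilon> i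
    using \<theta> by (simp_all add: shift_homomorphism_def algebra_hom_def)
  define K where "K = {y. \<theta> (\<iota> y) = Poly_Mapping.single 0 (\<iota> y)}"
  have "csubspace K"
    by (rule complex_vector.subspaceI)
      (simp_all add: K_def clinear_zero[OF \<iota>_lin] clinear_zero[OF \<theta>_lin] clinear_add[OF \<iota>_lin]
        clinear_add[OF \<theta>_lin] clinear_scale[OF \<iota>_lin] clinear_scale[OF \<theta>_lin]
        single_add scaleC_single)
  moreover have e_K: "e i \<in> K" and f_K: "f i \<in> K" for i
    by (simp_all add: K_def \<iota>_e \<iota>_f clinear_scale[OF \<theta>_lin] \<theta>_x scaleC_single)
  moreover have "bracket y z \<in> K" if "y \<in> K" "z \<in> K" for y z
    using that
    by (simp add: K_def \<iota>_bracket commutator_def clinear_diff[OF \<theta>_lin] \<theta>_mult mult_single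
        single_diff)
  ultimately have "K = UNIV"
    by (intro generated_by_chevalley_generators[OF sym]) blast+
  then show ?thesis by (auto simp: K_def)
qed

lemma funpow_cend_apply: "(cend_apply E ^^ n) v = cend_apply (E ^ n) v"
  by (induction n) (simp_all add: one_cend.rep_eq times_cend.rep_eq)

lemma funpow_contragredient:
  "cdual_apply ((contragredient E ^^ n) \<phi>) v = (- 1) ^ n * cdual_apply \<phi> (cend_apply (E ^ n) v)"
proof (induction n arbitrary: v)
  case 0
  show ?case by (simp add: one_cend.rep_eq)
next
  case (Suc n)
  have "cdual_apply ((contragredient E ^^ Suc n) \<phi>) v
      = - cdual_apply ((contragredient E ^^ n) \<phi>) (cend_apply E v)"
    by (simp add: contragredient.rep_eq)
  also have "\<dots> = (- 1) ^ Suc n * cdual_apply \<phi> (cend_apply (E ^ n * E) v)"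
    by (simp add: Suc times_cend.rep_eq)
  finally show ?case by (simp only: power_Suc2)
qed

theorem corollary3p17:
  fixes bracket :: "'g::complex_vector \<Rightarrow> 'g \<Rightarrow> 'g"
    and a :: "'i::finite \<Rightarrow> 'i \<Rightarrow> int"
    and d :: "'i \<Rightarrow> nat"
    and e h f :: "'i \<Rightarrow> 'g"
    and B :: "'g \<Rightarrow> 'g \<Rightarrow> complex"
    and xp xm :: "('i \<Rightarrow> int) \<Rightarrow> 'g"
    and hbar :: complex
    and \<xi> :: "'i \<Rightarrow> nat \<Rightarrow> 'y::complex_algebra_1"
    and x :: "pm \<Rightarrow> 'i \<Rightarrow> nat \<Rightarrow> 'y"
    and \<iota> :: "'g \<Rightarrow> 'y"
    and \<Delta> :: "'y \<Rightarrow> ('y, 'y) tensor"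
    and \<theta> :: "'y \<Rightarrow> (nat \<Rightarrow>\<^sub>0 'y)"
    and R :: "('y, 'y) tensor fps"
    and \<pi> :: "'y \<Rightarrow> 'v::complex_vector cend"
    and v :: 'v
    and \<phi> :: "'v cdual"
  assumes "chevalley_generators bracket a e h f"
    and "minimal_symmetrizer a d"
    and "normalized_invariant_form bracket a d h B"
    and "root_vectors bracket a h B xp xm"
    and "hbar \<noteq> 0"
    and "is_yangian a d hbar \<xi> x"
    and "yangian_embedding bracket d e h f \<xi> x \<iota>"
    and "yangian_coproduct bracket a d h xp xm hbar \<xi> \<iota> \<Delta>"
    and "shift_homomorphism \<xi> x \<theta>"
    and "universal_R_matrix \<Delta> \<theta> R"
    and "\<exists>S :: 'v set. finite S \<and> cspan S = UNIV"
    and "algebra_hom \<pi>"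
  shows "(\<forall>i. fps_map (tau (act_adjoint \<iota>) (e i) (f i)) (lifted_minor R \<pi> \<phi> v) =
              lifted_minor R \<pi> (tau (act_dual \<iota> \<pi>) (e i) (f i) \<phi>) (tau (act_module \<iota> \<pi>) (e i) (f i) v)) \<and>
         (\<forall>y. commutator (fps_const (\<iota> y)) (lifted_minor R \<pi> \<phi> v) =
              lifted_minor R \<pi> (act_dual \<iota> \<pi> y \<phi>) v + lifted_minor R \<pi> \<phi> (act_module \<iota> \<pi> y v))"
proof -
  interpret chevalley_generators bracket a e h f by fact
  have sym: "symmetrizer a d"
    using \<open>minimal_symmetrizer a d\<close> by (simp add: minimal_symmetrizer_def)
  note \<pi> = \<open>algebra_hom \<pi>\<close>
  have \<iota>_lin: "clinear \<iota>" and \<iota>_bracket: "\<iota> (bracket y z) = commutator (\<iota> y) (\<iota> z)" for y z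
    using \<open>yangian_embedding bracket d e h f \<xi> x \<iota>\<close> by (simp_all add: yangian_embedding_def)
  have \<theta>: "algebra_hom \<theta>"
    using \<open>shift_homomorphism \<xi> x \<theta>\<close> by (simp add: shift_homomorphism_def)
  have primitive: "\<Delta> (\<iota> y) = \<iota> y \<otimes>\<^sub>C 1 + 1 \<otimes>\<^sub>C \<iota> y" for y
    using \<open>yangian_coproduct bracket a d h xp xm hbar \<xi> \<iota> \<Delta>\<close> by (simp add: yangian_coproduct_def)
  have fixed: "\<theta> (\<iota> y) = Poly_Mapping.single 0 (\<iota> y)" for y
    by (rule shift_fixes_lie_algebra[OF assms(1) sym assms(7,9)])
  define L where "L n \<phi> v = fps_nth (lifted_minor R \<pi> \<phi> v) n" for n \<phi> v
  have L_bilinear: "cbilinear (L n)" for n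
    unfolding L_def lifted_minor_nth[OF \<pi>] by (rule cbilinear_matrix_coefficient_args[OF \<pi>])
  have derivation: "act_adjoint \<iota> y (L n \<phi> v) = L n (act_dual \<iota> \<pi> y \<phi>) v + L n \<phi> (act_module \<iota> \<pi> y v)"
    for y n \<phi> v
    unfolding L_def lifted_minor_nth[OF \<pi>] act_adjoint_def act_dual_def act_module_def
    by (rule commutator_matrix_coefficient[OF \<pi>])
      (simp only:
        R_matrix_commutes_with_primitive[OF \<open>universal_R_matrix \<Delta> \<theta> R\<close> \<theta> primitive fixed]
        mult_scaleC_left mult_scaleC_right)

  \<comment> \<open>The hypothesis \<open>[z, y] = c y\<close> makes \<open>y\<close> act nilpotently on \<open>V\<close>, hence also on its dual.\<close>
  have exp_L: "locally_nilpotent_exp (act_adjoint \<iota> y) (L n \<phi> v)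
      = L n (locally_nilpotent_exp (act_dual \<iota> \<pi> y) \<phi>) (locally_nilpotent_exp (act_module \<iota> \<pi> y) v)"
    if eigen: "bracket z y = c *\<^sub>C y" and c: "c \<noteq> 0" for z y c n \<phi> v
  proof -
    have "commutator (\<pi> (\<iota> z)) (\<pi> (\<iota> y)) = \<pi> (\<iota> (bracket z y))"
      using \<pi>
      by (simp add: \<iota>_bracket commutator_def algebra_hom_def clinear_diff[OF clinear_action[OF \<pi>]])
    also have "\<dots> = c *\<^sub>C \<pi> (\<iota> y)"
      by (simp add: eigen clinear_scale[OF \<iota>_lin] clinear_scale[OF clinear_action[OF \<pi>]])
    finally obtain N where N: "\<pi> (\<iota> y) ^ N = 0"
      using eigen_operator_nilpotent[OF assms(11) _ c] by blast
    have act_module: "act_module \<iota> \<pi> y = cend_apply (\<pi> (\<iota> y))"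
      and act_dual: "act_dual \<iota> \<pi> y = contragredient (\<pi> (\<iota> y))"
      by (simp_all add: fun_eq_iff act_module_def act_dual_def)
    show ?thesis
    proof (rule locally_nilpotent_exp_bilinear[where L = "L n" and Z = "act_dual \<iota> \<pi> y"
          and X = "act_module \<iota> \<pi> y" and M = N and N = N])
      show "cbilinear (L n)" by (rule L_bilinear)
      show "act_adjoint \<iota> y (L n \<phi> v) = L n (act_dual \<iota> \<pi> y \<phi>) v + L n \<phi> (act_module \<iota> \<pi> y v)" for \<phi> v
        by (rule derivation)
      show "clinear (act_adjoint \<iota> y)"
        by (rule clinearI)
          (simp_all add: act_adjoint_def clinear_add[OF clinear_commutator] clinear_scale[OF clinear_commutator])
      show "act_module \<iota> \<pi> y 0 = 0"
        by (simp add: act_module clinear_zero[OF clinear_cend_apply])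
      show "(act_module \<iota> \<pi> y ^^ N) v = 0"
        by (simp add: act_module funpow_cend_apply N zero_cend.rep_eq)
      show "act_dual \<iota> \<pi> y 0 = 0"
        by (rule cdual_apply_inject[THEN iffD1])
          (simp add: act_dual fun_eq_iff contragredient.rep_eq zero_cdual.rep_eq)
      show "(act_dual \<iota> \<pi> y ^^ N) \<phi> = 0"
        by (rule cdual_apply_inject[THEN iffD1])
          (simp add: act_dual fun_eq_iff funpow_contragredient N zero_cend.rep_eq zero_cdual.rep_eq
            clinear_zero[OF clinear_cdual_apply])
    qed
  qed
  have exp_e: "locally_nilpotent_exp (act_adjoint \<iota> (e i)) (L n \<phi> v)
      = L n (locally_nilpotent_exp (act_dual \<iota> \<pi> (e i)) \<phi>) (locally_nilpotent_exp (act_module \<iota> \<pi> (e i)) v)"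
    for i n \<phi> v
    by (rule exp_L[of "h i" _ 2]) (simp_all add: bracket_h_e cartan_diagonal)
  have exp_f: "locally_nilpotent_exp (act_adjoint \<iota> (- f i)) (L n \<phi> v)
      = L n (locally_nilpotent_exp (act_dual \<iota> \<pi> (- f i)) \<phi>) (locally_nilpotent_exp (act_module \<iota> \<pi> (- f i)) v)"
    for i n \<phi> v
    using clinear_diff[OF clinear_bracket_right, of "h i" 0 "f i"]
    by (intro exp_L[of "h i" _ "-2"])
      (simp_all add: bracket_h_f cartan_diagonal clinear_zero[OF clinear_bracket_right])
  have "fps_map (tau (act_adjoint \<iota>) (e i) (f i)) (lifted_minor R \<pi> \<phi> v)
      = lifted_minor R \<pi> (tau (act_dual \<iota> \<pi>) (e i) (f i) \<phi>) (tau (act_module \<iota> \<pi>) (e i) (f i) v)" for i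
    unfolding fps_eq_iff fps_map_def fps_nth_Abs_fps L_def[symmetric] tau_def exp_e exp_f by simp
  moreover have "commutator (fps_const (\<iota> y)) (lifted_minor R \<pi> \<phi> v)
      = lifted_minor R \<pi> (act_dual \<iota> \<pi> y \<phi>) v + lifted_minor R \<pi> \<phi> (act_module \<iota> \<pi> y v)" for y
    using derivation[of y _ \<phi> v]
    by (simp add: fps_eq_iff commutator_def act_adjoint_def L_def)
  ultimately show ?thesis by blast
qed

end
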